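(* Let $k\ge 1$, let $K\subset\mathbb{R}^2$ be a triangle and $\mathbf{a}\in\mathbb{R}^2$ a constant vector. Let $V$, the set $\mathcal{G}$ of boundary points, the index set $\mathcal{I}_k$, the linear forms $\delta_\sigma$ ($\sigma\in\mathcal{G}$) and $m_{\boldsymbol{\mu}}$ ($\boldsymbol{\mu}\in\mathcal{I}_k$), and the dual basis $\{\varphi_\sigma\}_{\sigma\in\mathcal{G}}\cup\{\varphi_{\boldsymbol{\mu}}\}_{\boldsymbol{\mu}\in\mathcal{I}_k}$ of $V$ be as defined in the context. Since $\mathbf{a}$ is constant, $\mathbf{a}\cdot\nabla u\in V$ for every $u\in V$. For a time-dependent $u_h(t)\in V$ let $$U=\big(\{\langle\delta_\sigma,u_h\rangle\}_{\sigma},\{\langle m_{\boldsymbol{\mu}},u_h\rangle\}_{\boldsymbol{\mu}}\big)^T,\qquad\text{so that}\qquad u_h=\sum_{\sigma}\langle\delta_\sigma,u_h\rangle\varphi_\sigma+\sum_{\boldsymbol{\mu}}\langle m_{\boldsymbol{\mu}},u_h\rangle\varphi_{\boldsymbol{\mu}},$$ let $\mathtt{M}$ be the mass matrix of the dual basis (entries $\int_K\varphi_\alpha\varphi_\beta\,d\mathbf{x}$, where $\alpha,\beta$ range over $\mathcal{G}\cup\mathcal{I}_k$), and let $F=(F_\alpha)_{\alpha\in\mathcal{G}\cup\mathcal{I}_k}$ with $$F_\alpha=-\int_K\nabla\varphi_\alpha\cdot(\mathbf{a}\,u_h)\,d\mathbf{x}+\oint_{\partial K}\varphi_\alpha\,u_h\,\mathbf{a}\cdot\mathbf{n}\,d\gamma=\int_K\varphi_\alpha\,\mathbf{a}\cdot\nabla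 u_h\,d\mathbf{x}.$$ Then the evolution of the point values and moments $$\frac{d}{dt}\langle\delta_\sigma,u_h\rangle+\langle\delta_\sigma,\mathbf{a}\cdot\nabla u_h\rangle=0\quad\forall\sigma\in\mathcal{G},\qquad \frac{d}{dt}\langle m_{\boldsymbol{\mu}},u_h\rangle+\langle m_{\boldsymbol{\mu}},\mathbf{a}\cdot\nabla u_h\rangle=0\quad\forall\boldsymbol{\mu}\in\mathcal{I}_k$$ is equivalent to the discontinuous Galerkin system $\mathtt{M}\frac{dU}{dt}+F=0$, i.e. $\frac{dU}{dt}+\mathtt{M}^{-1}F=0$; that is, $(\mathtt{M}^{-1}F)_\sigma=(\mathbf{a}\cdot\nabla u_h)(\sigma)$ and $(\mathtt{M}^{-1}F)_{\boldsymbol{\mu}}=\frac1{|K|}\int_K\boldsymbol{\lambda}^{\boldsymbol{\mu}}\,\mathbf{a}\cdot\nabla u_h\,d\mathbf{x}$.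
   Context: $\lambda_1,\lambda_2,\lambda_3$ are the barycentric coordinates of $K$, $b=\lambda_1\lambda_2\lambda_3$, $\boldsymbol{\lambda}^{\boldsymbol{\mu}}=\lambda_1^{\mu_1}\lambda_2^{\mu_2}\lambda_3^{\mu_3}$ and $|\boldsymbol{\mu}|=\mu_1+\mu_2+\mu_3$ for $\boldsymbol{\mu}\in\mathbb{N}^3$ (with $0\in\mathbb{N}$). $\mathbb{P}^k$ is the space of polynomials of degree at most $k$ in two variables, restricted to $K$. The space is $V=\mathbb{P}^k+b\,\mathbb{R}$ if $k\le 2$, and $V=\mathbb{P}^k+b\,\mathbb{P}^{k-2}$ if $k>2$. The set $\mathcal{I}_k$ is $\{(0,0,0)\}$ if $k\le 2$ and $\{\boldsymbol{\mu}\in\mathbb{N}^3:|\boldsymbol{\mu}|=k-2\}$ if $k>2$. The set $\mathcal{G}$ consists of the $3k$ points of $\partial K$ formed by the three vertices and, on each edge, the $k-1$ interior points of the $(k+1)$-point Gauss–Lobatto rule on that edge. The linear forms on $V$ are $\langle\delta_\sigma,p\rangle=p(\sigma)$ and $\langle m_{\boldsymbol{\mu}},p\rangle=\frac1{|K|}\int_K\boldsymbol{\lambda}^{\boldsymbol{\mu}}p\,d\mathbf{x}$; they are unisolvent on $V$, and the dual basis $\{\varphi_\sigma\},\{\varphi_{\boldsymbol{\mu}}\}$ of $V$ is defined by $\langle\delta_\sigma,\varphi_{\sigma'}\rangle=\delta_{\sigma\sigma'}$, $\langle\delta_\sigma,\varphi_{\boldsymbol{\mu}}\rangle=0$, $\langle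 m_{\boldsymbol{\mu}},\varphi_\sigma\rangle=0$, $\langle m_{\boldsymbol{\mu}},\varphi_{\boldsymbol{\mu}'}\rangle=\delta_{\boldsymbol{\mu}\boldsymbol{\mu}'}$ (Kronecker deltas on the right). $\mathbf{n}$ is the outward unit normal on $\partial K$. The equation being discretised in $K$ is $u_t+\mathbf{a}\cdot\nabla u=0$, with flux $\mathbf{f}(u)=\mathbf{a}u$ and an initial condition in $V$.
   Formalization: For k=1 the claim a·∇u∈V is false (a≠0, u=b), as are the formulas for M⁻¹F; so closure of V is asserted for k≥2, and the equivalence and M⁻¹F formulas hold for k≥2, or for k=1 when a·∇u_h(t)∈V. *)

theory Defs
  imports "HOL-Analysis.Analysis" "HOL-Computational_Algebra.Polynomial"
begin

text \<open>
  A triangle is given by its vertices \<open>v :: 3 \<Rightarrow> real^2\<close>. Arithmetic in the index type 3 is modulo 3,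
  so edge \<open>i\<close> joins \<open>v i\<close> to \<open>v (i + 1)\<close> and is opposite to \<open>v (i + 2)\<close>.
\<close>

definition triangle_of :: "(3 \<Rightarrow> real^2) \<Rightarrow> (real^2) set" where
  "triangle_of v = convex hull (range v)"

definition area :: "(3 \<Rightarrow> real^2) \<Rightarrow> real" where
  "area v = measure lborel (triangle_of v)"

definition bary :: "(3 \<Rightarrow> real^2) \<Rightarrow> real^2 \<Rightarrow> 3 \<Rightarrow> real" where
  "bary v x = (THE l. (\<Sum>i\<in>UNIV. l i) = 1 \<and> (\<Sum>i\<in>UNIV. l i *\<^sub>R v i) = x)"

definition bubble :: "(3 \<Rightarrow> real^2) \<Rightarrow> real^2 \<Rightarrow> real" where
  "bubble v x = (\<Prod>i\<in>UNIV. bary v x i)"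

definition bary_monom :: "(3 \<Rightarrow> real^2) \<Rightarrow> (3 \<Rightarrow> nat) \<Rightarrow> real^2 \<Rightarrow> real" where
  "bary_monom v \<mu> x = (\<Prod>i\<in>UNIV. bary v x i ^ \<mu> i)"

text \<open>
  A polynomial on the triangle is identified with the polynomial function on the whole plane that
  extends it; the extension is unique because a nondegenerate triangle has interior points.
\<close>

definition poly_space :: "nat \<Rightarrow> (real^2 \<Rightarrow> real) set" where
  "poly_space k =
     {p. \<exists>c :: nat \<Rightarrow> nat \<Rightarrow> real. \<forall>x. p x = (\<Sum>(i, j) | i + j \<le> k. c i j * (x$1) ^ i * (x$2) ^ j)}"

definition approx_space :: "(3 \<Rightarrow> real^2) \<Rightarrow> nat \<Rightarrow> (real^2 \<Rightarrow> real) set" where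
  "approx_space v k =
     (if k \<le> 2 then {\<lambda>x. p x + bubble v x * c | p c. p \<in> poly_space k}
      else {\<lambda>x. p x + bubble v x * q x | p q. p \<in> poly_space k \<and> q \<in> poly_space (k - 2)})"

definition moment_indices :: "nat \<Rightarrow> (3 \<Rightarrow> nat) set" where
  "moment_indices k = (if k \<le> 2 then {\<lambda>_. 0} else {\<mu>. (\<Sum>i\<in>UNIV. \<mu> i) = k - 2})"

text \<open>Rodrigues' formula.\<close>

definition legendre_poly :: "nat \<Rightarrow> real poly" where
  "legendre_poly n = smult (1 / (2 ^ n * fact n)) ((pderiv ^^ n) ([:-1, 0, 1:] ^ n))"

text \<open>
  The nodes of the \<open>(k+1)\<close>-point Gauss--Lobatto rule on \<open>[-1, 1]\<close> are the two end points and the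
  \<open>k-1\<close> zeros of the derivative of the Legendre polynomial of degree \<open>k\<close>.
\<close>

definition gauss_lobatto_interior :: "nat \<Rightarrow> real set" where
  "gauss_lobatto_interior k = {s \<in> {-1<..<1}. poly (pderiv (legendre_poly k)) s = 0}"

definition boundary_points :: "(3 \<Rightarrow> real^2) \<Rightarrow> nat \<Rightarrow> (real^2) set" where
  "boundary_points v k = range v \<union>
     {linepath (v i) (v (i + 1)) ((1 + s) / 2) | i s. s \<in> gauss_lobatto_interior k}"

text \<open>
  Degrees of freedom are indexed by the disjoint sum of the boundary points (left) and the moment
  multi-indices (right).
\<close>

definition dof_indices :: "(3 \<Rightarrow> real^2) \<Rightarrow> nat \<Rightarrow> (real^2 + (3 \<Rightarrow> nat)) set" where
  "dof_indices v k = boundary_points v k <+> moment_indices k"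

definition moment :: "(3 \<Rightarrow> real^2) \<Rightarrow> (3 \<Rightarrow> nat) \<Rightarrow> (real^2 \<Rightarrow> real) \<Rightarrow> real" where
  "moment v \<mu> p = 1 / area v * (LINT x:triangle_of v|lborel. bary_monom v \<mu> x * p x)"

fun dof :: "(3 \<Rightarrow> real^2) \<Rightarrow> real^2 + (3 \<Rightarrow> nat) \<Rightarrow> (real^2 \<Rightarrow> real) \<Rightarrow> real" where
  "dof v (Inl \<sigma>) p = p \<sigma>"
| "dof v (Inr \<mu>) p = moment v \<mu> p"

definition dual_basis ::
    "(3 \<Rightarrow> real^2) \<Rightarrow> nat \<Rightarrow> (real^2 + (3 \<Rightarrow> nat) \<Rightarrow> real^2 \<Rightarrow> real) \<Rightarrow> bool" where
  "dual_basis v k \<phi> \<longleftrightarrow>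
     (\<forall>\<alpha>\<in>dof_indices v k. \<phi> \<alpha> \<in> approx_space v k) \<and>
     (\<forall>\<alpha>\<in>dof_indices v k. \<forall>\<beta>\<in>dof_indices v k. dof v \<alpha> (\<phi> \<beta>) = (if \<alpha> = \<beta> then 1 else 0))"

definition grad :: "(real^2 \<Rightarrow> real) \<Rightarrow> real^2 \<Rightarrow> real^2" where
  "grad p x = (THE D. GDERIV p x :> D)"

text \<open>
  For \<open>k \<ge> 2\<close> this operator maps \<open>approx_space v k\<close> into itself. For \<open>k = 1\<close> it does not: the bubble is
  cubic, and its derivative along a nonzero \<open>a\<close> is quadratic and not in \<open>approx_space v 1\<close>.
\<close>

definition advect :: "real^2 \<Rightarrow> (real^2 \<Rightarrow> real) \<Rightarrow> real^2 \<Rightarrow> real" where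
  "advect a p x = a \<bullet> grad p x"

definition outward_normal :: "(3 \<Rightarrow> real^2) \<Rightarrow> 3 \<Rightarrow> real^2" where
  "outward_normal v i =
     (THE n. norm n = 1 \<and> n \<bullet> (v (i + 1) - v i) = 0 \<and> n \<bullet> (v (i + 2) - v i) < 0)"

text \<open>
  Arc-length integral over the boundary, edge by edge. The integrand receives the outward unit
  normal of the edge and the point on it.
\<close>

definition boundary_integral :: "(3 \<Rightarrow> real^2) \<Rightarrow> (real^2 \<Rightarrow> real^2 \<Rightarrow> real) \<Rightarrow> real" where
  "boundary_integral v g =
     (\<Sum>i\<in>UNIV. dist (v i) (v (i + 1)) *
        (LINT s:{0..1}|lborel. g (outward_normal v i) (linepath (v i) (v (i + 1)) s)))"

text \<open>
  Vectors and matrices indexed by a finite set \<open>I\<close>, as functions whose values outside \<open>I\<close> are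
  irrelevant.
\<close>

definition mat_vec :: "'i set \<Rightarrow> ('i \<Rightarrow> 'i \<Rightarrow> real) \<Rightarrow> ('i \<Rightarrow> real) \<Rightarrow> 'i \<Rightarrow> real" where
  "mat_vec I A x \<alpha> = (\<Sum>\<beta>\<in>I. A \<alpha> \<beta> * x \<beta>)"

definition is_inverse_on :: "'i set \<Rightarrow> ('i \<Rightarrow> 'i \<Rightarrow> real) \<Rightarrow> ('i \<Rightarrow> 'i \<Rightarrow> real) \<Rightarrow> bool" where
  "is_inverse_on I A B \<longleftrightarrow>
     (\<forall>\<alpha>\<in>I. \<forall>\<beta>\<in>I. (\<Sum>\<gamma>\<in>I. A \<alpha> \<gamma> * B \<gamma> \<beta>) = (if \<alpha> = \<beta> then 1 else 0) \<and>
                  (\<Sum>\<gamma>\<in>I. B \<alpha> \<gamma> * A \<gamma> \<beta>) = (if \<alpha> = \<beta> then 1 else 0))"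

definition invertible_on :: "'i set \<Rightarrow> ('i \<Rightarrow> 'i \<Rightarrow> real) \<Rightarrow> bool" where
  "invertible_on I A \<longleftrightarrow> (\<exists>B. is_inverse_on I A B)"

definition mat_inv_on :: "'i set \<Rightarrow> ('i \<Rightarrow> 'i \<Rightarrow> real) \<Rightarrow> 'i \<Rightarrow> 'i \<Rightarrow> real" where
  "mat_inv_on I A = (SOME B. is_inverse_on I A B)"

definition mass_matrix ::
    "(3 \<Rightarrow> real^2) \<Rightarrow> ('i \<Rightarrow> real^2 \<Rightarrow> real) \<Rightarrow> 'i \<Rightarrow> 'i \<Rightarrow> real" where
  "mass_matrix v \<phi> \<alpha> \<beta> = (LINT x:triangle_of v|lborel. \<phi> \<alpha> x * \<phi> \<beta> x)"

definition dg_residual ::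
    "(3 \<Rightarrow> real^2) \<Rightarrow> real^2 \<Rightarrow> ('i \<Rightarrow> real^2 \<Rightarrow> real) \<Rightarrow> (real^2 \<Rightarrow> real) \<Rightarrow> 'i \<Rightarrow> real" where
  "dg_residual v a \<phi> w \<alpha> =
     - (LINT x:triangle_of v|lborel. grad (\<phi> \<alpha>) x \<bullet> (w x *\<^sub>R a))
     + boundary_integral v (\<lambda>n x. \<phi> \<alpha> x * w x * (a \<bullet> n))"

text \<open>
  The semidiscrete systems at time \<open>t\<close>. Derivatives are taken within the time domain \<open>T\<close>, hence
  one-sided at its end points; \<open>D\<close> is the time derivative of the vector of degrees of freedom.
\<close>

definition dof_evolution ::
    "(3 \<Rightarrow> real^2) \<Rightarrow> nat \<Rightarrow> real^2 \<Rightarrow> real set \<Rightarrow> (real \<Rightarrow> real^2 \<Rightarrow> real) \<Rightarrow> real \<Rightarrow> bool" where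
  "dof_evolution v k a T u t \<longleftrightarrow>
     (\<forall>\<sigma>\<in>boundary_points v k. \<exists>d.
        ((\<lambda>s. u s \<sigma>) has_real_derivative d) (at t within T) \<and> d + advect a (u t) \<sigma> = 0) \<and>
     (\<forall>\<mu>\<in>moment_indices k. \<exists>d.
        ((\<lambda>s. moment v \<mu> (u s)) has_real_derivative d) (at t within T) \<and>
        d + moment v \<mu> (advect a (u t)) = 0)"

definition dg_system ::
    "(3 \<Rightarrow> real^2) \<Rightarrow> nat \<Rightarrow> (real^2 + (3 \<Rightarrow> nat) \<Rightarrow> real^2 \<Rightarrow> real) \<Rightarrow> real^2 \<Rightarrow> real set \<Rightarrow>
      (real \<Rightarrow> real^2 \<Rightarrow> real) \<Rightarrow> real \<Rightarrow> bool" where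
  "dg_system v k \<phi> a T u t \<longleftrightarrow>
     (\<exists>D. (\<forall>\<alpha>\<in>dof_indices v k. ((\<lambda>s. dof v \<alpha> (u s)) has_real_derivative D \<alpha>) (at t within T)) \<and>
          (\<forall>\<alpha>\<in>dof_indices v k.
             mat_vec (dof_indices v k) (mass_matrix v \<phi>) D \<alpha> + dg_residual v a \<phi> (u t) \<alpha> = 0))"

definition dg_system_explicit ::
    "(3 \<Rightarrow> real^2) \<Rightarrow> nat \<Rightarrow> (real^2 + (3 \<Rightarrow> nat) \<Rightarrow> real^2 \<Rightarrow> real) \<Rightarrow> real^2 \<Rightarrow> real set \<Rightarrow>
      (real \<Rightarrow> real^2 \<Rightarrow> real) \<Rightarrow> real \<Rightarrow> bool" where
  "dg_system_explicit v k \<phi> a T u t \<longleftrightarrow>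
     (\<exists>D. (\<forall>\<alpha>\<in>dof_indices v k. ((\<lambda>s. dof v \<alpha> (u s)) has_real_derivative D \<alpha>) (at t within T)) \<and>
          (\<forall>\<alpha>\<in>dof_indices v k.
             D \<alpha> + mat_vec (dof_indices v k) (mat_inv_on (dof_indices v k) (mass_matrix v \<phi>))
                     (dg_residual v a \<phi> (u t)) \<alpha> = 0))"

end

theory Submission
  imports Defs
begin

text \<open>
  Write \<open>b\<close> for the bubble and \<open>\<lambda>\<^sub>1, \<lambda>\<^sub>2, \<lambda>\<^sub>3\<close> for the barycentric coordinates. Two facts make the point and
  moment equations a discontinuous Galerkin method in disguise. Integration by parts gives
  \<open>F\<^sub>\<alpha> = \<integral> \<phi>\<^sub>\<alpha> a \<bullet> \<nabla>u\<close> (lemma \<open>dg_residual_eq\<close>). And since the dual functions span the space, \<open>a \<bullet> \<nabla>u\<close>, when it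
  belongs to the space, is the combination of the \<open>\<phi>\<^sub>\<beta>\<close> whose coefficients are its own degrees of freedom
  (lemma \<open>dual_expansion\<close>). Together they say that \<open>F\<close> is the mass matrix applied to the vector of degrees of
  freedom of \<open>a \<bullet> \<nabla>u\<close>. The mass matrix is the Gram matrix of linearly independent functions, hence
  invertible, and \<open>M\<inverse> F\<close> is that vector (lemma \<open>solved_residual\<close>).

  Spanning follows from unisolvence: an element of the space all of whose degrees of freedom vanish is 0.
  As \<open>b\<close> vanishes on the boundary, the polynomial part \<open>p\<close> of such an element vanishes at all boundary
  nodes. An edge carries \<open>k + 1\<close> of them, so \<open>p\<close> vanishes on every edge and is divisible by
  \<open>b = \<lambda>\<^sub>1 \<lambda>\<^sub>2 \<lambda>\<^sub>3\<close>. The element is therefore \<open>b h\<close> with \<open>h\<close> of degree at most \<open>k - 2\<close>. Because the coordinates add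
  up to 1, the barycentric monomials of degree \<open>k - 2\<close> span the polynomials of degree at most \<open>k - 2\<close>, so
  the vanishing moments give \<open>\<integral> b h\<^sup>2 = 0\<close> and \<open>h = 0\<close>. That an edge has \<open>k + 1\<close> distinct nodes means that the
  derivative of the Legendre polynomial has \<open>k - 1\<close> zeros in \<open>(-1, 1)\<close>, which is Rolle's theorem
  applied repeatedly to Rodrigues' formula.

  Integration by parts rests on the divergence theorem for polynomials on a triangle. By linearity it is
  enough to differentiate along a side; an affine map to the reference triangle, Fubini's theorem and the
  fundamental theorem of calculus then yield the edge integrals. In this form the flux through an
  edge is expressed by the linear part of the opposite barycentric coordinate, which is matched with the
  outward normal.
\<close>

section \<open>Linear systems over a finite index set\<close>

text \<open>
  Elimination of one unknown at a time. Let \<open>z\<close> and \<open>w\<close> solve the smaller system with the new column and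
  with \<open>y\<close> as right-hand sides. Then \<open>w - t z\<close>, with new entry \<open>t\<close>, solves all old equations, and the new
  equation is linear in \<open>t\<close>. Its leading coefficient \<open>c\<close> is nonzero, as otherwise \<open>- z\<close> with new entry 1
  would lie in the kernel of the whole matrix. Definiteness is assumed rather than injectivity because
  it is inherited by principal submatrices.
\<close>

lemma definite_system_solvable:
  fixes A :: "'i \<Rightarrow> 'i \<Rightarrow> real"
  assumes "finite I"
    and "\<And>x. (\<Sum>\<alpha>\<in>I. x \<alpha> * mat_vec I A x \<alpha>) = 0 \<Longrightarrow> \<forall>\<alpha>\<in>I. x \<alpha> = 0"
  shows "\<exists>x. \<forall>\<alpha>\<in>I. mat_vec I A x \<alpha> = y \<alpha>"
  using assms
proof (induction I arbitrary: y rule: finite_induct)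
  case (insert i I)
  have mv: "mat_vec (insert i I) A x \<alpha> = A \<alpha> i * x i + mat_vec I A x \<alpha>" for x \<alpha>
    using insert.hyps by (simp add: mat_vec_def)
  have upd: "mat_vec I A (x(i := c)) \<alpha> = mat_vec I A x \<alpha>" for x c \<alpha>
    unfolding mat_vec_def using insert.hyps by (intro sum.cong) auto
  have "\<forall>\<alpha>\<in>I. x \<alpha> = 0" if "(\<Sum>\<alpha>\<in>I. x \<alpha> * mat_vec I A x \<alpha>) = 0" for x
  proof -
    have "(\<Sum>\<alpha>\<in>I. (x(i := 0)) \<alpha> * mat_vec I A x \<alpha>) = (\<Sum>\<alpha>\<in>I. x \<alpha> * mat_vec I A x \<alpha>)"
      using insert.hyps by (intro sum.cong) auto
    then have "\<forall>\<alpha>\<in>insert i I. (x(i := 0)) \<alpha> = 0"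
      using that insert.hyps
      by (intro insert.prems) (simp add: mv upd del: fun_upd_apply add: fun_upd_same)
    then show ?thesis using insert.hyps by (metis fun_upd_other insert_iff)
  qed
  note solve = insert.IH[OF this]
  obtain z where z: "\<forall>\<alpha>\<in>I. mat_vec I A z \<alpha> = A \<alpha> i" using solve[of "\<lambda>\<alpha>. A \<alpha> i"] by auto
  obtain w where w: "\<forall>\<alpha>\<in>I. mat_vec I A w \<alpha> = y \<alpha>" using solve[of y] by auto
  have lin: "mat_vec I A (\<lambda>\<beta>. w \<beta> - t * z \<beta>) \<alpha> = mat_vec I A w \<alpha> - t * mat_vec I A z \<alpha>" for t w \<alpha>
    by (simp add: mat_vec_def algebra_simps sum_subtractf sum_distrib_left)
  define c where "c = A i i - mat_vec I A z i"
  have "c \<noteq> 0"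
  proof
    assume "c = 0"
    let ?x = "(\<lambda>\<beta>. 0 - 1 * z \<beta>)(i := 1)"
    have "\<forall>\<alpha>\<in>insert i I. mat_vec (insert i I) A ?x \<alpha> = 0"
      using \<open>c = 0\<close> z unfolding mv upd lin by (auto simp: c_def mat_vec_def)
    then have "(\<Sum>\<alpha>\<in>insert i I. ?x \<alpha> * mat_vec (insert i I) A ?x \<alpha>) = 0"
      by (intro sum.neutral ballI) (simp only: mult_zero_right)
    then have "\<forall>\<alpha>\<in>insert i I. ?x \<alpha> = 0"
      by (rule insert.prems)
    then show False by auto
  qed
  define t where "t = (y i - mat_vec I A w i) / c"
  let ?x = "(\<lambda>\<beta>. w \<beta> - t * z \<beta>)(i := t)"
  have "t * c = y i - mat_vec I A w i" using \<open>c \<noteq> 0\<close> by (simp add: t_def)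
  then have "\<forall>\<alpha>\<in>insert i I. mat_vec (insert i I) A ?x \<alpha> = y \<alpha>"
    using z w unfolding mv upd lin by (auto simp: c_def algebra_simps)
  then show ?case by blast
qed simp

lemma definite_imp_invertible_on:
  fixes A :: "'i \<Rightarrow> 'i \<Rightarrow> real"
  assumes fin: "finite I"
    and sym: "\<And>\<alpha> \<beta>. A \<alpha> \<beta> = A \<beta> \<alpha>"
    and def: "\<And>x. (\<Sum>\<alpha>\<in>I. x \<alpha> * mat_vec I A x \<alpha>) = 0 \<Longrightarrow> \<forall>\<alpha>\<in>I. x \<alpha> = 0"
  shows "invertible_on I A"
proof -
  have "\<forall>\<beta>. \<exists>x. \<forall>\<alpha>\<in>I. mat_vec I A x \<alpha> = (if \<alpha> = \<beta> then 1 else 0)"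
    by (intro allI definite_system_solvable[OF fin]) (rule def)
  then obtain X where X: "\<And>\<alpha> \<beta>. \<alpha> \<in> I \<Longrightarrow> mat_vec I A (X \<beta>) \<alpha> = (if \<alpha> = \<beta> then 1 else 0)"
    by metis
  have sX: "X \<beta> \<alpha> = X \<alpha> \<beta>" if "\<alpha> \<in> I" "\<beta> \<in> I" for \<alpha> \<beta>
  proof -
    have "X \<beta> \<alpha> = (\<Sum>\<gamma>\<in>I. X \<beta> \<gamma> * mat_vec I A (X \<alpha>) \<gamma>)"
      using fin that by (simp add: X if_distrib[of "\<lambda>z. _ * z"] cong: if_cong)
    also have "\<dots> = (\<Sum>\<gamma>\<in>I. X \<alpha> \<gamma> * mat_vec I A (X \<beta>) \<gamma>)"
      unfolding mat_vec_def sum_distrib_left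
      by (subst sum.swap) (simp add: sym mult_ac)
    also have "\<dots> = X \<alpha> \<beta>"
      using fin that by (simp add: X if_distrib[of "\<lambda>z. _ * z"] cong: if_cong)
    finally show ?thesis .
  qed
  have "is_inverse_on I A (\<lambda>\<gamma> \<beta>. X \<beta> \<gamma>)"
    unfolding is_inverse_on_def
  proof (intro ballI conjI)
    fix \<alpha> \<beta> assume ab: "\<alpha> \<in> I" "\<beta> \<in> I"
    show "(\<Sum>\<gamma>\<in>I. A \<alpha> \<gamma> * X \<beta> \<gamma>) = (if \<alpha> = \<beta> then 1 else 0)"
      using X[of \<alpha> \<beta>] ab by (simp add: mat_vec_def)
    have "(\<Sum>\<gamma>\<in>I. X \<gamma> \<alpha> * A \<gamma> \<beta>) = (\<Sum>\<gamma>\<in>I. A \<beta> \<gamma> * X \<alpha> \<gamma>)"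
      using ab sX sym by (intro sum.cong) (auto simp: mult.commute)
    then show "(\<Sum>\<gamma>\<in>I. X \<gamma> \<alpha> * A \<gamma> \<beta>) = (if \<alpha> = \<beta> then 1 else 0)"
      using X[of \<beta> \<alpha>] ab by (auto simp: mat_vec_def)
  qed
  then show ?thesis unfolding invertible_on_def by blast
qed

lemma mat_inv_on_vec:
  assumes "finite I" "invertible_on I A" "\<alpha> \<in> I"
  shows "mat_vec I (mat_inv_on I A) (mat_vec I A x) \<alpha> = x \<alpha>"
    and "mat_vec I A (mat_vec I (mat_inv_on I A) x) \<alpha> = x \<alpha>"
proof -
  have inv: "is_inverse_on I A (mat_inv_on I A)"
    using assms(2) unfolding invertible_on_def mat_inv_on_def by (rule someI_ex)
  have comp: "mat_vec I B (mat_vec I C x) \<alpha> = x \<alpha>"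
    if "\<And>\<beta>. \<beta> \<in> I \<Longrightarrow> (\<Sum>\<gamma>\<in>I. B \<alpha> \<gamma> * C \<gamma> \<beta>) = (if \<alpha> = \<beta> then 1 else 0)" for B C
  proof -
    have "mat_vec I B (mat_vec I C x) \<alpha> = (\<Sum>\<beta>\<in>I. (\<Sum>\<gamma>\<in>I. B \<alpha> \<gamma> * C \<gamma> \<beta>) * x \<beta>)"
      unfolding mat_vec_def sum_distrib_left sum_distrib_right
      by (subst sum.swap) (simp add: mult.assoc)
    also have "\<dots> = x \<alpha>"
      using assms(1,3) by (simp add: that if_distrib[of "\<lambda>z. z * _"] cong: if_cong)
    finally show ?thesis .
  qed
  show "mat_vec I (mat_inv_on I A) (mat_vec I A x) \<alpha> = x \<alpha>"
    and "mat_vec I A (mat_vec I (mat_inv_on I A) x) \<alpha> = x \<alpha>"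
    using inv assms(3) unfolding is_inverse_on_def by (auto intro!: comp)
qed

lemma mat_vec_cong: "(\<And>\<beta>. \<beta> \<in> I \<Longrightarrow> x \<beta> = y \<beta>) \<Longrightarrow> mat_vec I A x \<alpha> = mat_vec I A y \<alpha>"
  unfolding mat_vec_def by (intro sum.cong) auto

lemma mat_vec_uminus: "mat_vec I A (\<lambda>\<beta>. - x \<beta>) \<alpha> = - mat_vec I A x \<alpha>"
  by (simp add: mat_vec_def sum_negf)

lemma linear_system_solved_form:
  assumes "finite I" "invertible_on I A"
  shows "(\<forall>\<alpha>\<in>I. mat_vec I A x \<alpha> + y \<alpha> = 0) \<longleftrightarrow> (\<forall>\<alpha>\<in>I. x \<alpha> + mat_vec I (mat_inv_on I A) y \<alpha> = 0)"
proof (intro iffI ballI)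
  fix \<alpha> assume *: "\<forall>\<alpha>\<in>I. mat_vec I A x \<alpha> + y \<alpha> = 0" and "\<alpha> \<in> I"
  have "mat_vec I (mat_inv_on I A) y \<alpha> = mat_vec I (mat_inv_on I A) (\<lambda>\<beta>. - mat_vec I A x \<beta>) \<alpha>"
    using * by (intro mat_vec_cong) (simp add: eq_neg_iff_add_eq_0 add.commute)
  then show "x \<alpha> + mat_vec I (mat_inv_on I A) y \<alpha> = 0"
    using mat_inv_on_vec(1)[OF assms \<open>\<alpha> \<in> I\<close>] by (simp add: mat_vec_uminus)
next
  fix \<alpha> assume *: "\<forall>\<alpha>\<in>I. x \<alpha> + mat_vec I (mat_inv_on I A) y \<alpha> = 0" and "\<alpha> \<in> I"
  have "mat_vec I A x \<alpha> = mat_vec I A (\<lambda>\<beta>. - mat_vec I (mat_inv_on I A) y \<beta>) \<alpha>"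
    using * by (intro mat_vec_cong) (simp add: eq_neg_iff_add_eq_0)
  then show "mat_vec I A x \<alpha> + y \<alpha> = 0"
    using mat_inv_on_vec(2)[OF assms \<open>\<alpha> \<in> I\<close>] by (simp add: mat_vec_uminus)
qed

section \<open>Gauss--Lobatto nodes\<close>

text \<open>
  Rolle's theorem between consecutive zeros. The bounds on \<open>Z\<close> keep the new zeros away from the end
  points \<open>-1\<close> and \<open>1\<close> when the lemma is iterated in Rodrigues' formula.
\<close>

lemma pderiv_zeros_between:
  fixes p :: "real poly"
  assumes "finite S" "card S = Suc n" "\<And>x. x \<in> S \<Longrightarrow> poly p x = 0"
  shows "\<exists>Z. finite Z \<and> card Z = n \<and> Z \<subseteq> {Min S<..<Max S} \<and> (\<forall>x\<in>Z. poly (pderiv p) x = 0)"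
  using assms
proof (induction n arbitrary: S)
  case 0
  show ?case by (intro exI[of _ "{}"]) auto
next
  case (Suc n)
  define M where "M = Max S"
  define R where "R = S - {M}"
  have "S \<noteq> {}" using Suc.prems by auto
  then have "M \<in> S" using Suc.prems by (simp add: M_def)
  have R: "finite R" "card R = Suc n" "S = insert M R" "M \<notin> R"
    using Suc.prems \<open>M \<in> S\<close> by (auto simp: R_def)
  then have "R \<noteq> {}" by auto
  obtain Z where Z: "finite Z" "card Z = n" "Z \<subseteq> {Min R<..<Max R}" "\<forall>x\<in>Z. poly (pderiv p) x = 0"
    using Suc.IH[of R] R Suc.prems by auto
  have "Max R \<in> R" using R \<open>R \<noteq> {}\<close> by simp
  have "Max R \<le> M" using Suc.prems R \<open>Max R \<in> R\<close> unfolding M_def by (intro Max_ge) auto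
  then have "Max R < M" using R \<open>Max R \<in> R\<close> by (metis less_eq_real_def)
  then obtain z where z: "Max R < z" "z < M" "poly p M - poly p (Max R) = (M - Max R) * poly (pderiv p) z"
    using poly_MVT by blast
  have "poly (pderiv p) z = 0"
    using z \<open>Max R < M\<close> Suc.prems(3)[OF \<open>M \<in> S\<close>] Suc.prems(3)[of "Max R"] \<open>Max R \<in> R\<close> R by auto
  moreover have "Min S \<le> Min R" using R \<open>R \<noteq> {}\<close> by simp
  moreover have "Min R \<le> Max R" using R \<open>Max R \<in> R\<close> by simp
  moreover have "z \<notin> Z" using Z z by auto
  ultimately show ?case
    using Z z \<open>Max R < M\<close> unfolding M_def[symmetric]
    by (intro exI[of _ "insert z Z"]) (auto simp: subset_iff)
qed

lemma power_dvd_pderiv: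
  fixes p q :: "real poly"
  assumes "q ^ Suc n dvd p"
  shows "q ^ n dvd pderiv p"
proof -
  obtain r where "p = q ^ Suc n * r" using assms by (rule dvdE)
  then have "pderiv p = q ^ n * (q * pderiv r + smult (of_nat (Suc n)) (r * pderiv q))"
    by (simp add: pderiv_mult pderiv_power_Suc algebra_simps del: power_Suc) (simp add: algebra_simps)
  then show ?thesis by (rule dvdI)
qed

lemma power_dvd_iterated_pderiv:
  fixes q :: "real poly"
  assumes "j \<le> k"
  shows "q ^ (k - j) dvd (pderiv ^^ j) (q ^ k)"
  using assms
proof (induction j)
  case (Suc j)
  then have "q ^ Suc (k - Suc j) dvd (pderiv ^^ j) (q ^ k)" by (simp add: Suc_diff_Suc del: power_Suc)
  then show ?case by (simp add: power_dvd_pderiv)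
qed simp

text \<open>
  For \<open>j < k\<close> the end points remain zeros of the \<open>j\<close>-th derivative because \<open>x\<^sup>2 - 1\<close> still divides it;
  together with the \<open>j\<close> interior zeros they give, by Rolle, one more interior zero of the next derivative.
\<close>

lemma rodrigues_zeros:
  assumes "j \<le> k"
  shows "\<exists>S. finite S \<and> card S = j \<and> S \<subseteq> {-1<..<1} \<and>
    (\<forall>x\<in>S. poly ((pderiv ^^ j) ([:-1, 0, 1:] ^ k)) x = (0::real))"
  using assms
proof (induction j)
  case 0
  show ?case by (intro exI[of _ "{}"]) auto
next
  case (Suc j)
  let ?p = "(pderiv ^^ j) ([:-1, 0, 1 :: real:] ^ k)"
  obtain S where S: "finite S" "card S = j" "S \<subseteq> {-1<..<1}" "\<forall>x\<in>S. poly ?p x = 0"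
    using Suc by auto
  have "[:-1, 0, 1 :: real:] ^ 1 dvd [:-1, 0, 1:] ^ (k - j)"
    using Suc.prems by (intro le_imp_power_dvd) simp
  also have "\<dots> dvd ?p" using Suc.prems by (intro power_dvd_iterated_pderiv) simp
  finally have "[:-1, 0, 1:] dvd ?p" unfolding power_one_right .
  then obtain r where r: "?p = [:-1, 0, 1:] * r" by (rule dvdE)
  have ends: "poly ?p (-1) = 0" "poly ?p 1 = 0" unfolding r poly_mult by simp_all
  let ?T = "insert (-1) (insert 1 S)"
  have "-1 \<notin> insert 1 S" "1 \<notin> S" using S(3) by auto
  then have "card ?T = Suc (Suc j)" using S(1,2) by simp
  moreover have "poly ?p x = 0" if "x \<in> ?T" for x
    using that S(4) ends by blast
  ultimately have "\<exists>Z. finite Z \<and> card Z = Suc j \<and> Z \<subseteq> {Min ?T<..<Max ?T} \<and>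
      (\<forall>x\<in>Z. poly (pderiv ?p) x = 0)"
    using S(1) by (intro pderiv_zeros_between) simp_all
  moreover have "Min ?T = -1" using S(1,3) by (intro Min_eqI) auto
  moreover have "Max ?T = 1" using S(1,3) by (intro Max_eqI) auto
  ultimately show ?case by (simp only: funpow.simps o_apply)
qed

lemma gauss_lobatto_interior_card:
  assumes "k \<ge> 1"
  shows "finite (gauss_lobatto_interior k)" "k - 1 \<le> card (gauss_lobatto_interior k)"
proof -
  let ?q = "(pderiv ^^ k) ([:-1, 0, 1 :: real:] ^ k)"
  have eq: "gauss_lobatto_interior k = {s \<in> {-1<..<1}. poly (pderiv ?q) s = 0}"
    by (auto simp: gauss_lobatto_interior_def legendre_poly_def pderiv_smult)
  have "degree ((pderiv ^^ j) ([:-1, 0, 1 :: real:] ^ k)) = 2 * k - j" for j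
    by (induction j) (auto simp: degree_pderiv degree_power_eq)
  then have "degree ?q = k" by simp
  then have "pderiv ?q \<noteq> 0" using assms by (simp add: pderiv_eq_0_iff)
  then have "finite {s. poly (pderiv ?q) s = 0}" by (rule poly_roots_finite)
  then show fin: "finite (gauss_lobatto_interior k)" unfolding eq by simp
  obtain S where S: "finite S" "card S = k" "S \<subseteq> {-1<..<1}" "\<forall>x\<in>S. poly ?q x = 0"
    using rodrigues_zeros[of k k] by auto
  obtain Z where Z: "finite Z" "card Z = k - 1" "Z \<subseteq> {Min S<..<Max S}" "\<forall>x\<in>Z. poly (pderiv ?q) x = 0"
    using pderiv_zeros_between[of S "k - 1" ?q] S assms by auto
  have "S \<noteq> {}" using S assms by auto
  then have "Min S \<in> S" "Max S \<in> S" using S by auto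
  then have "Z \<subseteq> gauss_lobatto_interior k"
    unfolding eq using Z S by force
  then show "k - 1 \<le> card (gauss_lobatto_interior k)"
    using card_mono[OF fin] Z by metis
qed

section \<open>Polynomials in two variables\<close>

text \<open>
  Polynomials of degree at most \<open>k\<close> in two given functions. Taking Cartesian coordinates gives
  \<open>poly_space\<close>, and taking two barycentric coordinates gives the same space in the variables that are
  adapted to one edge of the triangle.
\<close>

definition pspace :: "('a \<Rightarrow> real) \<Rightarrow> ('a \<Rightarrow> real) \<Rightarrow> nat \<Rightarrow> ('a \<Rightarrow> real) set" where
  "pspace f g k = {p. \<exists>c :: nat \<Rightarrow> nat \<Rightarrow> real. \<forall>x. p x = (\<Sum>(i, j) | i + j \<le> k. c i j * f x ^ i * g x ^ j)}"

lemma poly_space_eq_pspace: "poly_space k = pspace (\<lambda>x. x $ 1) (\<lambda>x. x $ 2) k"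
  unfolding poly_space_def pspace_def ..

lemma finite_exponents: "finite {(i, j). i + j \<le> (k::nat)}"
  by (rule finite_subset[of _ "{..k} \<times> {..k}"]) auto

lemma pspace_scale: "p \<in> pspace f g k \<Longrightarrow> (\<lambda>x. c * p x) \<in> pspace f g k"
proof -
  assume "p \<in> pspace f g k"
  then obtain d where "\<And>x. p x = (\<Sum>(i, j) | i + j \<le> k. d i j * f x ^ i * g x ^ j)"
    unfolding pspace_def by blast
  then show ?thesis
    unfolding pspace_def
    by (intro CollectI exI[of _ "\<lambda>i j. c * d i j"])
      (simp add: sum_distrib_left mult.assoc case_prod_unfold)
qed

lemma pspace_add:
  assumes "p \<in> pspace f g k" "q \<in> pspace f g k"
  shows "(\<lambda>x. p x + q x) \<in> pspace f g k"
proof -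
  obtain c where "\<And>x. p x = (\<Sum>(i, j) | i + j \<le> k. c i j * f x ^ i * g x ^ j)"
    using assms unfolding pspace_def by blast
  moreover obtain d where "\<And>x. q x = (\<Sum>(i, j) | i + j \<le> k. d i j * f x ^ i * g x ^ j)"
    using assms unfolding pspace_def by blast
  ultimately show ?thesis
    unfolding pspace_def
    by (intro CollectI exI[of _ "\<lambda>i j. c i j + d i j"])
      (simp add: sum.distrib[symmetric] algebra_simps case_prod_unfold)
qed

lemma pspace_monom:
  assumes "i + j \<le> k"
  shows "(\<lambda>x. f x ^ i * g x ^ j) \<in> pspace f g k"
proof -
  have "f x ^ i * g x ^ j =
    (\<Sum>(m, n) | m + n \<le> k. (if (m, n) = (i, j) then 1 else 0) * f x ^ m * g x ^ n)" for x
    using assms finite_exponents[of k]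
    by (subst sum.mono_neutral_cong_right[of _ "{(i, j)}"]) (auto split: if_splits)
  then show ?thesis
    unfolding pspace_def
    by (intro CollectI exI[of _ "\<lambda>m n. if (m, n) = (i, j) then 1 else 0"] allI)
qed

lemma pspace_zero: "(\<lambda>x. 0) \<in> pspace f g k"
  using pspace_scale[OF pspace_monom[of 0 0 k f g], of 0] by simp

lemma pspace_sum: "(\<And>i. i \<in> I \<Longrightarrow> p i \<in> pspace f g k) \<Longrightarrow> (\<lambda>x. \<Sum>i\<in>I. p i x) \<in> pspace f g k"
  by (induction I rule: infinite_finite_induct) (auto simp: pspace_zero intro: pspace_add)

lemma pspace_induct [consumes 1, case_names zero monom add scale]:
  assumes "p \<in> pspace f g k"
    and zero: "P (\<lambda>x. 0)"
    and monom: "\<And>i j. i + j \<le> k \<Longrightarrow> P (\<lambda>x. f x ^ i * g x ^ j)"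
    and add: "\<And>p q. P p \<Longrightarrow> P q \<Longrightarrow> P (\<lambda>x. p x + q x)"
    and scale: "\<And>c p. P p \<Longrightarrow> P (\<lambda>x. c * p x)"
  shows "P p"
proof -
  obtain c where "\<And>x. p x = (\<Sum>(i, j) | i + j \<le> k. c i j * f x ^ i * g x ^ j)"
    using assms(1) unfolding pspace_def by blast
  then have p: "p = (\<lambda>x. \<Sum>ij | fst ij + snd ij \<le> k. c (fst ij) (snd ij) * (f x ^ fst ij * g x ^ snd ij))"
    by (simp add: fun_eq_iff case_prod_unfold mult.assoc)
  have "P (\<lambda>x. \<Sum>ij\<in>A. c (fst ij) (snd ij) * (f x ^ fst ij * g x ^ snd ij))"
    if "finite A" "A \<subseteq> {ij. fst ij + snd ij \<le> k}" for A
    using that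
    by (induction A rule: finite_induct) (auto intro!: zero add scale[OF monom])
  then show ?thesis
    unfolding p using finite_exponents[of k] by (simp add: case_prod_unfold)
qed

lemma pspace_mono: "p \<in> pspace f g k \<Longrightarrow> k \<le> l \<Longrightarrow> p \<in> pspace f g l"
  by (induction rule: pspace_induct) (auto intro: pspace_zero pspace_monom pspace_add pspace_scale)

lemma pspace_mult:
  assumes "p \<in> pspace f g k" "q \<in> pspace f g l"
  shows "(\<lambda>x. p x * q x) \<in> pspace f g (k + l)"
  using assms(1)
proof (induction rule: pspace_induct)
  case (monom i j)
  show ?case using assms(2)
  proof (induction rule: pspace_induct)
    case (monom m n)
    have "(\<lambda>x. f x ^ (i + m) * g x ^ (j + n)) \<in> pspace f g (k + l)"
      using monom \<open>i + j \<le> k\<close> by (intro pspace_monom) simp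
    then show ?case by (simp add: power_add mult_ac)
  next
    case (add p q)
    then show ?case using pspace_add by (auto simp: distrib_left)
  next
    case (scale c p)
    then show ?case using pspace_scale[OF scale, of c] by (simp add: mult_ac)
  qed (simp add: pspace_zero)
next
  case (add p q)
  then show ?case using pspace_add by (auto simp: distrib_right)
next
  case (scale c p)
  then show ?case using pspace_scale[OF scale, of c] by (simp add: mult_ac)
qed (simp add: pspace_zero)

lemma pspace_const: "(\<lambda>x. c) \<in> pspace f g k"
  using pspace_scale[OF pspace_monom[of 0 0 k f g], of c] by simp

lemma pspace_power:
  assumes "p \<in> pspace f g k"
  shows "(\<lambda>x. p x ^ n) \<in> pspace f g (n * k)"
proof (induction n)
  case (Suc n)
  then show ?case using pspace_mult[OF assms Suc] by (simp add: add.commute)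
qed (simp add: pspace_const)

lemma pspace_subst:
  assumes "f \<in> pspace f' g' 1" "g \<in> pspace f' g' 1"
  shows "pspace f g k \<subseteq> pspace f' g' k"
proof
  fix p assume "p \<in> pspace f g k"
  then show "p \<in> pspace f' g' k"
  proof (induction rule: pspace_induct)
    case (monom i j)
    have "(\<lambda>x. f x ^ i * g x ^ j) \<in> pspace f' g' (i * 1 + j * 1)"
      using assms by (intro pspace_mult pspace_power)
    then show ?case using monom by (auto intro: pspace_mono)
  qed (auto intro: pspace_zero pspace_add pspace_scale)
qed

lemma poly_space_addI: "p \<in> poly_space k \<Longrightarrow> q \<in> poly_space k \<Longrightarrow> (\<lambda>x. p x + q x) \<in> poly_space k"
  unfolding poly_space_eq_pspace by (rule pspace_add)

lemma poly_space_multI: "p \<in> poly_space k \<Longrightarrow> q \<in> poly_space l \<Longrightarrow> (\<lambda>x. p x * q x) \<in> poly_space (k + l)"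
  unfolding poly_space_eq_pspace by (rule pspace_mult)

lemma poly_space_affine: "(\<lambda>x. c + c1 * x $ 1 + c2 * x $ 2) \<in> poly_space 1"
proof -
  have "(\<lambda>x::real^2. x $ 1) \<in> poly_space 1"
    using pspace_monom[of 1 0 1] by (simp add: poly_space_eq_pspace)
  moreover have "(\<lambda>x::real^2. x $ 2) \<in> poly_space 1"
    using pspace_monom[of 0 1 1] by (simp add: poly_space_eq_pspace)
  ultimately show ?thesis
    unfolding poly_space_eq_pspace by (intro pspace_add pspace_scale pspace_const)
qed

lemma poly_space_0: "poly_space 0 = range (\<lambda>c x. c)"
proof
  show "poly_space 0 \<subseteq> range (\<lambda>c x. c)"
  proof
    fix p assume "p \<in> poly_space 0"
    then show "p \<in> range (\<lambda>c x. c)"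
      unfolding poly_space_eq_pspace by (induction rule: pspace_induct) (auto simp: fun_eq_iff image_iff)
  qed
qed (auto simp: poly_space_eq_pspace pspace_const)

lemma poly_space_along_line:
  assumes "p \<in> poly_space k"
  shows "\<exists>r. degree r \<le> k \<and> (\<forall>t. p (c + t *\<^sub>R d) = poly r t)"
  using assms unfolding poly_space_eq_pspace
proof (induction rule: pspace_induct)
  case zero
  show ?case by (intro exI[of _ 0]) auto
next
  case (monom i j)
  let ?r = "[:c $ 1, d $ 1:] ^ i * [:c $ 2, d $ 2:] ^ j"
  have "degree ([:c $ n, d $ n:] ^ m) \<le> m" for n m
    using degree_power_le[of "[:c $ n, d $ n:]" m] by (auto split: if_splits)
  then have "degree ?r \<le> i + j"
    by (meson add_mono degree_mult_le order_trans)
  then show ?case using monom by (intro exI[of _ ?r]) auto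
next
  case (add p q)
  then obtain r s where "degree r \<le> k" "\<forall>t. p (c + t *\<^sub>R d) = poly r t"
    "degree s \<le> k" "\<forall>t. q (c + t *\<^sub>R d) = poly s t" by blast
  then show ?case by (intro exI[of _ "r + s"]) (auto intro: degree_add_le)
next
  case (scale a p)
  then obtain r where "degree r \<le> k" "\<forall>t. p (c + t *\<^sub>R d) = poly r t" by blast
  then show ?case by (intro exI[of _ "smult a r"]) auto
qed

text \<open>
  Along the line from a point of the open set to \<open>x\<close> the polynomial has infinitely many zeros.
\<close>

lemma poly_space_zero_on_open:
  assumes "p \<in> poly_space k" "open S" "c \<in> S" "\<And>x. x \<in> S \<Longrightarrow> p x = 0"
  shows "p x = 0"
proof -
  obtain r where r: "\<And>t. p (c + t *\<^sub>R (x - c)) = poly r t"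
    using poly_space_along_line[OF assms(1)] by blast
  have "open ((\<lambda>t. c + t *\<^sub>R (x - c)) -` S)"
    by (intro open_vimage assms continuous_intros)
  moreover have "0 \<in> (\<lambda>t. c + t *\<^sub>R (x - c)) -` S" using assms by simp
  ultimately have "infinite ((\<lambda>t::real. c + t *\<^sub>R (x - c)) -` S)"
    using finite_imp_not_open by blast
  moreover have "(\<lambda>t. c + t *\<^sub>R (x - c)) -` S \<subseteq> {t. poly r t = 0}"
    using assms(4) by (auto simp: r[symmetric])
  ultimately have "infinite {t. poly r t = 0}"
    using finite_subset by blast
  then have "r = 0" using poly_roots_finite by blast
  then show ?thesis using r[of 1] by simp
qed

lemma grad_eqI:
  assumes "GDERIV p x :> D"
  shows "grad p x = D"
  unfolding grad_def
proof (rule the_equality)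
  show "GDERIV p x :> D" by (fact assms)
  fix E assume "GDERIV p x :> E"
  then have "(\<lambda>h. h \<bullet> D) = (\<lambda>h. h \<bullet> E)"
    using assms unfolding gderiv_def by (metis has_derivative_unique)
  then show "E = D" by (metis inner_commute vector_eq_ldot)
qed

lemma GDERIV_power:
  assumes "GDERIV f x :> D"
  shows "GDERIV (\<lambda>x. f x ^ n) x :> (of_nat n * f x ^ (n - 1)) *\<^sub>R D"
  by (rule GDERIV_DERIV_compose[OF assms]) (auto intro!: derivative_eq_intros)

lemma GDERIV_component: "GDERIV (\<lambda>x::real^'n. x $ i) x :> axis i 1"
  unfolding gderiv_def
  by (simp add: inner_axis bounded_linear_imp_has_derivative bounded_linear_vec_nth)

lemma poly_space_gradient:
  assumes "p \<in> poly_space k"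
  shows "\<exists>D. (\<forall>x. GDERIV p x :> D x) \<and> (\<forall>a. (\<lambda>x. a \<bullet> D x) \<in> poly_space (k - 1))"
  using assms unfolding poly_space_eq_pspace
proof (induction rule: pspace_induct)
  case zero
  show ?case by (intro exI[of _ "\<lambda>x. 0"]) (auto simp: GDERIV_const pspace_zero)
next
  case (monom i j)
  let ?f = "\<lambda>x::real^2. x $ 1 ^ i" and ?g = "\<lambda>x::real^2. x $ 2 ^ j"
  let ?df = "\<lambda>x::real^2. (of_nat i * x $ 1 ^ (i - 1)) *\<^sub>R axis 1 1"
    and ?dg = "\<lambda>x::real^2. (of_nat j * x $ 2 ^ (j - 1)) *\<^sub>R axis 2 1"
  have D: "GDERIV (\<lambda>x. ?f x * ?g x) x :> ?f x *\<^sub>R ?dg x + ?g x *\<^sub>R ?df x" for x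
    by (intro GDERIV_mult GDERIV_power GDERIV_component)
  have "(\<lambda>x. a $ 2 * (of_nat j * (x $ 1 ^ i * x $ 2 ^ (j - 1)))
      + a $ 1 * (of_nat i * (x $ 1 ^ (i - 1) * x $ 2 ^ j)))
    \<in> pspace (\<lambda>x. x $ 1) (\<lambda>x::real^2. x $ 2) (k - 1)" (is "?q \<in> _") for a :: "real^2"
  proof (intro pspace_add)
    show "(\<lambda>x::real^2. a $ 2 * (of_nat j * (x $ 1 ^ i * x $ 2 ^ (j - 1)))) \<in> pspace (\<lambda>x. x $ 1) (\<lambda>x. x $ 2) (k - 1)"
      using monom by (cases "j = 0") (auto simp: pspace_zero intro!: pspace_scale pspace_monom)
    show "(\<lambda>x::real^2. a $ 1 * (of_nat i * (x $ 1 ^ (i - 1) * x $ 2 ^ j))) \<in> pspace (\<lambda>x. x $ 1) (\<lambda>x. x $ 2) (k - 1)"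
      using monom by (cases "i = 0") (auto simp: pspace_zero intro!: pspace_scale pspace_monom)
  qed
  then show ?case
    by (intro exI[of _ "\<lambda>x. ?f x *\<^sub>R ?dg x + ?g x *\<^sub>R ?df x"])
      (use D in \<open>auto simp: inner_add_right inner_axis mult_ac\<close>)
next
  case (add p q)
  then obtain D E where
    "\<And>x. GDERIV p x :> D x" "\<And>a. (\<lambda>x. a \<bullet> D x) \<in> pspace (\<lambda>x. x $ 1) (\<lambda>x. x $ 2) (k - 1)"
    "\<And>x. GDERIV q x :> E x" "\<And>a. (\<lambda>x. a \<bullet> E x) \<in> pspace (\<lambda>x. x $ 1) (\<lambda>x. x $ 2) (k - 1)" by blast
  then show ?case
    by (intro exI[of _ "\<lambda>x. D x + E x"]) (auto simp: inner_add_right intro: pspace_add GDERIV_add)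
next
  case (scale c p)
  then obtain D where D:
    "\<And>x. GDERIV p x :> D x" "\<And>a. (\<lambda>x. a \<bullet> D x) \<in> pspace (\<lambda>x. x $ 1) (\<lambda>x. x $ 2) (k - 1)" by blast
  have "GDERIV (\<lambda>x. c * p x) x :> c *\<^sub>R D x" for x
    using GDERIV_mult[OF GDERIV_const D(1), of c x] by simp
  then show ?case
    using D by (intro exI[of _ "\<lambda>x. c *\<^sub>R D x"]) (auto intro: pspace_scale)
qed

lemma poly_space_GDERIV: "p \<in> poly_space k \<Longrightarrow> GDERIV p x :> grad p x"
  using poly_space_gradient grad_eqI by metis

lemma advect_poly_space:
  assumes "p \<in> poly_space k"
  shows "advect a p \<in> poly_space (k - 1)"
proof -
  obtain D where D: "\<And>x. GDERIV p x :> D x" "(\<lambda>x. a \<bullet> D x) \<in> poly_space (k - 1)"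
    using poly_space_gradient[OF assms] by blast
  then have "advect a p = (\<lambda>x. a \<bullet> D x)"
    by (simp add: advect_def fun_eq_iff grad_eqI[OF D(1)])
  then show ?thesis using D by simp
qed

lemma advect_add:
  assumes "p \<in> poly_space k" "q \<in> poly_space l"
  shows "advect a (\<lambda>x. p x + q x) = (\<lambda>x. advect a p x + advect a q x)"
  using grad_eqI[OF GDERIV_add[OF poly_space_GDERIV[OF assms(1)] poly_space_GDERIV[OF assms(2)]]]
  by (simp add: advect_def fun_eq_iff inner_add_right)

lemma advect_mult:
  assumes "p \<in> poly_space k" "q \<in> poly_space l"
  shows "advect a (\<lambda>x. p x * q x) = (\<lambda>x. p x * advect a q x + q x * advect a p x)"
  using grad_eqI[OF GDERIV_mult[OF poly_space_GDERIV[OF assms(1)] poly_space_GDERIV[OF assms(2)]]]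
  by (simp add: advect_def fun_eq_iff inner_add_right)

lemma poly_space_continuous_on: "p \<in> poly_space k \<Longrightarrow> continuous_on S p"
  unfolding poly_space_eq_pspace
  by (induction rule: pspace_induct) (auto intro!: continuous_intros)

text \<open>
  Collecting the terms without \<open>f\<close> in \<open>r\<close>. With \<open>f = 0\<close> the equation of an edge, \<open>r\<close> is the restriction of
  \<open>p\<close> to that edge, so that \<open>f\<close> divides \<open>p\<close> as soon as \<open>r\<close> has too many zeros. The case \<open>k = 0\<close> is
  recorded separately because \<open>k - 1\<close> is truncated there.
\<close>

lemma pspace_split_first:
  assumes "p \<in> pspace f g k"
  shows "\<exists>q r. q \<in> pspace f g (k - 1) \<and> (k = 0 \<longrightarrow> q = (\<lambda>x. 0)) \<and> degree r \<le> k \<and>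
    (\<forall>x. p x = f x * q x + poly r (g x))"
  using assms
proof (induction rule: pspace_induct)
  case zero
  show ?case by (intro exI[of _ "\<lambda>x. 0"] exI[of _ 0]) (auto simp: pspace_zero)
next
  case (monom i j)
  show ?case
  proof (cases i)
    case 0
    then show ?thesis
      using monom by (intro exI[of _ "\<lambda>x. 0"] exI[of _ "Polynomial.monom 1 j"])
        (auto simp: pspace_zero degree_monom_eq poly_monom)
  next
    case (Suc m)
    then show ?thesis
      using monom by (intro exI[of _ "\<lambda>x. f x ^ m * g x ^ j"] exI[of _ 0]) (auto intro: pspace_monom)
  qed
next
  case (add p1 p2)
  then obtain q1 r1 q2 r2 where
    "q1 \<in> pspace f g (k - 1)" "k = 0 \<longrightarrow> q1 = (\<lambda>x. 0)" "degree r1 \<le> k"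
    "\<forall>x. p1 x = f x * q1 x + poly r1 (g x)"
    "q2 \<in> pspace f g (k - 1)" "k = 0 \<longrightarrow> q2 = (\<lambda>x. 0)" "degree r2 \<le> k"
    "\<forall>x. p2 x = f x * q2 x + poly r2 (g x)" by blast
  then show ?case
    by (intro exI[of _ "\<lambda>x. q1 x + q2 x"] exI[of _ "r1 + r2"])
      (auto simp: algebra_simps intro: pspace_add degree_add_le)
next
  case (scale c p)
  then obtain q r where
    "q \<in> pspace f g (k - 1)" "k = 0 \<longrightarrow> q = (\<lambda>x. 0)" "degree r \<le> k"
    "\<forall>x. p x = f x * q x + poly r (g x)" by blast
  then show ?case
    by (intro exI[of _ "\<lambda>x. c * q x"] exI[of _ "smult c r"])
      (auto simp: algebra_simps pspace_zero intro: pspace_scale)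
qed

section \<open>Barycentric coordinates\<close>

text \<open>
  The simplifier adds numerals before it reduces them modulo 3, which produces the sums up to 3 + 2.
\<close>

lemma index3_simps [simp]: "(3::3) + 1 = 1" "(4::3) = 1" "(5::3) = 2"
  by simp_all

lemma index3_distinct [simp]: "(i::3) \<noteq> i + 1" "i \<noteq> i + 2" "i + 1 \<noteq> i + 2" "i + 1 \<noteq> i" "i + 2 \<noteq> i" "i + 2 \<noteq> i + 1"
  using exhaust_3[of i] by auto

lemma sum_3_from: "(\<Sum>j\<in>UNIV. f j) = f i + f (i + 1) + f ((i::3) + 2)" for f :: "3 \<Rightarrow> 'a::comm_monoid_add"
  using exhaust_3[of i] by (auto simp: sum_3 add_ac)

lemma prod_3_from: "(\<Prod>j\<in>UNIV. f j) = f i * f (i + 1) * f ((i::3) + 2)" for f :: "3 \<Rightarrow> 'a::comm_monoid_mult"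
  using exhaust_3[of i] unfolding UNIV_3 by (auto simp: mult_ac)

definition cross2 :: "real^2 \<Rightarrow> real^2 \<Rightarrow> real" where
  "cross2 x y = x $ 1 * y $ 2 - x $ 2 * y $ 1"

lemma cross2_zero_imp_collinear:
  assumes "cross2 (y - x) (z - x) = 0"
  shows "collinear {y, z, x}"
proof (cases "y = x")
  case False
  define d e where "d = y - x" and "e = z - x"
  have "d $ 1 \<noteq> 0 \<or> d $ 2 \<noteq> 0"
    using False by (auto simp: d_def vec_eq_iff forall_2)
  moreover have "d $ 1 * e $ 2 = d $ 2 * e $ 1"
    using assms by (simp add: cross2_def d_def e_def)
  ultimately have "e = (e $ 1 / d $ 1) *\<^sub>R d \<or> e = (e $ 2 / d $ 2) *\<^sub>R d"
    by (auto simp: vec_eq_iff forall_2 field_simps)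
  then have "\<exists>u. z - x = u *\<^sub>R (y - x)" unfolding d_def e_def by blast
  then obtain u where "z - x = u *\<^sub>R (y - x)" ..
  then have "z = u *\<^sub>R y + (1 - u) *\<^sub>R x" by (simp add: algebra_simps)
  then show ?thesis unfolding collinear_3_expand by blast
qed (simp add: insert_commute)

lemma set_integrable_compact:
  fixes f :: "'a::euclidean_space \<Rightarrow> real"
  assumes "compact S" "continuous_on S f"
  shows "set_integrable lborel S f"
  unfolding set_integrable_def using borel_integrable_compact[OF assms] by simp

text \<open>
  The formulas for the barycentric coordinates are invariant under the cyclic relabelling \<open>i \<mapsto> i + 1\<close> of
  the vertices, which is why they are stated for the index triple \<open>i, i + 1, i + 2\<close>.
\<close>

locale triangle =
  fixes v :: "3 \<Rightarrow> real^2"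
  assumes noncollinear: "\<not> collinear (range v)"
begin

definition signed_double_area :: real where "signed_double_area = cross2 (v 2 - v 1) (v 3 - v 1)"

lemma signed_double_area_nonzero: "signed_double_area \<noteq> 0"
proof
  assume "signed_double_area = 0"
  then have "collinear {v 2, v 3, v 1}" unfolding signed_double_area_def by (rule cross2_zero_imp_collinear)
  moreover have "range v = {v 2, v 3, v 1}" unfolding UNIV_3 by auto
  ultimately show False using noncollinear by simp
qed

lemma signed_double_area_from: "signed_double_area = cross2 (v (i + 1) - v i) (v (i + 2) - v i)"
  using exhaust_3[of i] by (auto simp: signed_double_area_def cross2_def algebra_simps)

text \<open>
  Cramer's rule: a barycentric coordinate is the ratio of the signed areas of two triangles. The
  remaining properties of the coordinates reduce to polynomial identities by means of this formula.
\<close>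

lemma bary_eq: "bary v x i = cross2 (v (i + 1) - x) (v (i + 2) - x) / signed_double_area"
proof -
  define l where "l i = cross2 (v (i + 1) - x) (v (i + 2) - x) / signed_double_area" for i
  have "bary v x = l"
    unfolding bary_def
  proof (rule the_equality)
    have "l 1 + l 2 + l 3 = 1"
      using signed_double_area_nonzero by (simp add: l_def field_simps) (simp add: cross2_def signed_double_area_def algebra_simps)
    moreover have "(l 1 *\<^sub>R v 1 + l 2 *\<^sub>R v 2 + l 3 *\<^sub>R v 3) $ j = x $ j" if "j = 1 \<or> j = 2" for j
      using signed_double_area_nonzero that by (auto simp: l_def field_simps) (auto simp: cross2_def signed_double_area_def algebra_simps)
    ultimately show "(\<Sum>i\<in>UNIV. l i) = 1 \<and> (\<Sum>i\<in>UNIV. l i *\<^sub>R v i) = x"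
      by (simp add: sum_3 vec_eq_iff forall_2)
  next
    fix m assume m: "(\<Sum>i\<in>UNIV. m i) = 1 \<and> (\<Sum>i\<in>UNIV. m i *\<^sub>R v i) = x"
    then have x: "x = m 1 *\<^sub>R v 1 + m 2 *\<^sub>R v 2 + m 3 *\<^sub>R v 3" and m1: "m 1 = 1 - m 2 - m 3"
      by (auto simp: sum_3)
    have "m i = l i" for i
      using signed_double_area_nonzero exhaust_3[of i] unfolding l_def x
      by (auto simp: field_simps m1) (auto simp: cross2_def signed_double_area_def algebra_simps)
    then show "m = l" by blast
  qed
  then show ?thesis by (simp add: l_def)
qed

lemma sum_bary: "(\<Sum>i\<in>UNIV. bary v x i) = 1"
  using signed_double_area_nonzero by (simp add: sum_3 bary_eq field_simps) (simp add: cross2_def signed_double_area_def algebra_simps)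

lemma bary_combination: "(\<Sum>i\<in>UNIV. bary v x i *\<^sub>R v i) = x"
proof -
  have "(bary v x 1 *\<^sub>R v 1 + bary v x 2 *\<^sub>R v 2 + bary v x 3 *\<^sub>R v 3) $ j = x $ j" if "j = 1 \<or> j = 2" for j
    using signed_double_area_nonzero that by (auto simp: bary_eq field_simps) (auto simp: cross2_def signed_double_area_def algebra_simps)
  then show ?thesis by (simp add: sum_3 vec_eq_iff forall_2)
qed

lemma bary_vertex: "bary v (v j) i = (if i = j then 1 else 0)"
  using signed_double_area_nonzero exhaust_3[of i] exhaust_3[of j]
  by (auto simp: bary_eq) (auto simp: cross2_def signed_double_area_def algebra_simps)

lemma bary_affine_combination:
  assumes "s + t = 1"
  shows "bary v (s *\<^sub>R x + t *\<^sub>R y) i = s * bary v x i + t * bary v y i"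
proof -
  have s: "s = 1 - t" using assms by simp
  show ?thesis
    unfolding bary_eq s using signed_double_area_nonzero
    by (simp add: field_simps) (simp add: cross2_def algebra_simps)
qed

lemma bary_poly_space: "(\<lambda>x. bary v x i) \<in> poly_space 1"
proof -
  let ?p = "v (i + 1)" and ?q = "v (i + 2)"
  have "(\<lambda>x. bary v x i) = (\<lambda>x. cross2 ?p ?q / signed_double_area + ((?p $ 2 - ?q $ 2) / signed_double_area) * x $ 1 + ((?q $ 1 - ?p $ 1) / signed_double_area) * x $ 2)"
    using signed_double_area_nonzero by (simp add: fun_eq_iff bary_eq field_simps) (simp add: cross2_def algebra_simps)
  then show ?thesis by (simp only: poly_space_affine)
qed

lemma poly_space_bary: "poly_space k = pspace (\<lambda>x. bary v x i) (\<lambda>x. bary v x (i + 1)) k"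
proof
  show "poly_space k \<subseteq> pspace (\<lambda>x. bary v x i) (\<lambda>x. bary v x (i + 1)) k"
    unfolding poly_space_eq_pspace
  proof (rule pspace_subst)
    have "(\<lambda>x. x $ n) \<in> pspace (\<lambda>x. bary v x i) (\<lambda>x. bary v x (i + 1)) 1" for n
    proof -
      let ?l = "\<lambda>i x. bary v x i"
      have eq: "x $ n = v (i + 2) $ n + (v i $ n - v (i + 2) $ n) * (?l i x ^ 1 * ?l (i + 1) x ^ 0)
          + (v (i + 1) $ n - v (i + 2) $ n) * (?l i x ^ 0 * ?l (i + 1) x ^ 1)" for x
      proof -
        have l: "?l (i + 2) x = 1 - ?l i x - ?l (i + 1) x"
          using sum_bary[of x] sum_3_from[of "bary v x" i] by simp
        have x: "x $ n = ?l i x * v i $ n + ?l (i + 1) x * v (i + 1) $ n + ?l (i + 2) x * v (i + 2) $ n"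
          using arg_cong[OF bary_combination[of x], of "\<lambda>y. y $ n"] by (simp add: sum_3_from[of _ i])
        show ?thesis unfolding x l by (simp add: algebra_simps)
      qed
      then show ?thesis
        by (subst eq) (intro pspace_add pspace_scale pspace_const pspace_monom; simp)
    qed
    then show "(\<lambda>x. x $ 1) \<in> pspace (\<lambda>x. bary v x i) (\<lambda>x. bary v x (i + 1)) 1"
      and "(\<lambda>x. x $ 2) \<in> pspace (\<lambda>x. bary v x i) (\<lambda>x. bary v x (i + 1)) 1" by blast+
  qed
  show "pspace (\<lambda>x. bary v x i) (\<lambda>x. bary v x (i + 1)) k \<subseteq> poly_space k"
    unfolding poly_space_eq_pspace
    using bary_poly_space unfolding poly_space_eq_pspace by (intro pspace_subst)
qed

lemma continuous_bary: "continuous_on S (\<lambda>x. bary v x i)"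
  using bary_poly_space poly_space_continuous_on by blast

lemma bubble_eq: "bubble v x = bary v x 1 * bary v x 2 * bary v x 3"
  using prod_3_from[of "bary v x" 1] by (simp add: bubble_def)

lemma bubble_poly_space: "bubble v \<in> poly_space 3"
proof -
  have "(\<lambda>x. bary v x 1 * bary v x 2 * bary v x 3) \<in> poly_space (1 + 1 + 1)"
    using bary_poly_space unfolding poly_space_eq_pspace by (intro pspace_mult)
  then show ?thesis by (simp add: bubble_eq[abs_def] numeral_3_eq_3)
qed

lemma bary_monom_poly_space: "bary_monom v \<mu> \<in> poly_space (\<Sum>i\<in>UNIV. \<mu> i)"
proof -
  have "(\<lambda>x. bary v x 1 ^ \<mu> 1 * bary v x 2 ^ \<mu> 2 * bary v x 3 ^ \<mu> 3) \<in> poly_space (\<mu> 1 * 1 + \<mu> 2 * 1 + \<mu> 3 * 1)"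
    using bary_poly_space unfolding poly_space_eq_pspace by (intro pspace_mult pspace_power)
  moreover have "bary_monom v \<mu> = (\<lambda>x. bary v x 1 ^ \<mu> 1 * bary v x 2 ^ \<mu> 2 * bary v x 3 ^ \<mu> 3)"
    by (simp add: fun_eq_iff bary_monom_def prod_3_from[of _ 1])
  ultimately show ?thesis by (simp add: sum_3)
qed

lemma triangle_eq: "triangle_of v = {x. \<forall>i. 0 \<le> bary v x i}"
proof
  have "convex {x. \<forall>i. 0 \<le> bary v x i}"
    by (auto simp: convex_def bary_affine_combination)
  then show "triangle_of v \<subseteq> {x. \<forall>i. 0 \<le> bary v x i}"
    unfolding triangle_of_def by (intro hull_minimal) (auto simp: bary_vertex)
  show "{x. \<forall>i. 0 \<le> bary v x i} \<subseteq> triangle_of v"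
  proof
    fix x assume "x \<in> {x. \<forall>i. 0 \<le> bary v x i}"
    then have "(\<Sum>i\<in>UNIV. bary v x i *\<^sub>R v i) \<in> triangle_of v"
      unfolding triangle_of_def
      by (intro convex_sum convex_convex_hull sum_bary) (auto intro: hull_inc)
    then show "x \<in> triangle_of v" by (simp only: bary_combination)
  qed
qed

lemma compact_triangle: "compact (triangle_of v)"
  unfolding triangle_of_def by (intro finite_imp_compact_convex_hull) simp

lemma set_integrable_poly:
  assumes "p \<in> poly_space k"
  shows "set_integrable lborel (triangle_of v) p"
  by (rule set_integrable_compact[OF compact_triangle poly_space_continuous_on[OF assms]])

text \<open>
  The integrand vanishes almost everywhere on the triangle, hence on its open interior by continuity,
  hence everywhere because it is a polynomial.
\<close>

lemma nonneg_poly_integral_zero: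
  assumes p: "p \<in> poly_space k"
    and nonneg: "\<And>x. x \<in> triangle_of v \<Longrightarrow> 0 \<le> p x"
    and zero: "(LINT x:triangle_of v|lborel. p x) = 0"
  shows "p x = 0"
proof -
  let ?U = "{x. \<forall>i. 0 < bary v x i}"
  have open_U: "open ?U"
  proof -
    have "?U = (\<Inter>i. {x. 0 < bary v x i})" by auto
    then show ?thesis
      by (auto intro!: open_INT open_Collect_less continuous_bary)
  qed
  have U_sub: "?U \<subseteq> triangle_of v" by (auto simp: triangle_eq less_imp_le)
  \<comment> \<open>the centroid\<close>
  let ?c = "(1/3) *\<^sub>R v 1 + (2/3) *\<^sub>R ((1/2) *\<^sub>R v 2 + (1/2) *\<^sub>R v 3)"
  have "?c \<in> ?U"
    by (auto simp: bary_affine_combination bary_vertex forall_3)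
  have "AE x in lborel. indicator (triangle_of v) x *\<^sub>R p x = 0"
    using set_integrable_poly[OF p] zero nonneg
    by (subst integral_nonneg_eq_0_iff_AE[symmetric])
      (auto simp: set_integrable_def set_lebesgue_integral_def indicator_def)
  then have "AE x in lborel. x \<notin> ?U \<inter> {x. p x \<noteq> 0}"
    by eventually_elim (use U_sub in \<open>auto simp: indicator_def split: if_splits\<close>)
  moreover have open_V: "open (?U \<inter> {x. p x \<noteq> 0})"
    by (intro open_Int open_U open_Collect_neq poly_space_continuous_on[OF p] continuous_on_const)
  ultimately have "?U \<inter> {x. p x \<noteq> 0} \<in> null_sets lborel"
    by (subst AE_iff_null_sets) auto
  then have "negligible (?U \<inter> {x. p x \<noteq> 0})"
    by (simp add: negligible_iff_null_sets null_sets_completionI)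
  then have "?U \<inter> {x. p x \<noteq> 0} = {}"
    using open_V open_not_negligible by blast
  then have "p x = 0" if "x \<in> ?U" for x using that by blast
  then show ?thesis
    using poly_space_zero_on_open[OF p open_U \<open>?c \<in> ?U\<close>] by blast
qed

lemma area_nonzero: "area v \<noteq> 0"
proof
  assume "area v = 0"
  then have "(LINT x:triangle_of v|lborel. (1::real)) = 0"
    by (simp add: area_def set_lebesgue_integral_def)
  then have "(1::real) = 0"
    using nonneg_poly_integral_zero[of "\<lambda>x. 1" 0 0] by (auto simp: poly_space_0)
  then show False by simp
qed

end

section \<open>Unisolvence\<close>

text \<open>
  For \<open>k \<le> 2\<close> the truncated difference \<open>k - 2\<close> is 0 and the second polynomial is a constant, so the two
  cases in the definitions of the space and of the moments are one.
\<close>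

lemma approx_space_eq:
  "approx_space v k = {\<lambda>x. p x + bubble v x * q x | p q. p \<in> poly_space k \<and> q \<in> poly_space (k - 2)}"
proof (cases "k \<le> 2")
  case True
  have "(\<exists>p c. f = (\<lambda>x. p x + bubble v x * c) \<and> p \<in> poly_space k) \<longleftrightarrow>
      (\<exists>p q. f = (\<lambda>x. p x + bubble v x * q x) \<and> p \<in> poly_space k \<and> q \<in> range (\<lambda>c x. c))" for f
    by fast
  moreover have "poly_space (k - 2) = range (\<lambda>c x. c)"
    unfolding poly_space_0[symmetric] using True by simp
  ultimately show ?thesis using True unfolding approx_space_def by (simp only: if_True)
qed (simp add: approx_space_def)

lemma moment_indices_eq: "moment_indices k = {\<mu>. (\<Sum>i\<in>UNIV. \<mu> i) = k - 2}"
proof (cases "k \<le> 2")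
  case True
  have "(\<mu> = (\<lambda>_. 0)) = ((\<Sum>i\<in>UNIV. \<mu> i) = (0::nat))" for \<mu> :: "3 \<Rightarrow> nat"
    by (auto simp: fun_eq_iff sum_3 forall_3)
  moreover have "k - 2 = 0" using True by simp
  ultimately show ?thesis using True unfolding moment_indices_def by auto
qed (simp add: moment_indices_def)

context triangle
begin

text \<open>
  A polynomial of degree at most \<open>k\<close> with more than \<open>k\<close> zeros on the line \<open>\<lambda>\<^sub>i = 0\<close> vanishes on that line,
  so \<open>\<lambda>\<^sub>i\<close> divides it. The other coordinate \<open>\<lambda>\<^sub>i\<^sub>+\<^sub>1\<close> parametrises the line.
\<close>

lemma divide_by_bary:
  assumes p: "p \<in> poly_space k"
    and S: "k < card S" "\<And>x. x \<in> S \<Longrightarrow> bary v x i = 0" "\<And>x. x \<in> S \<Longrightarrow> p x = 0"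
  shows "\<exists>q\<in>poly_space (k - 1). (k = 0 \<longrightarrow> q = (\<lambda>x. 0)) \<and> (\<forall>x. p x = bary v x i * q x)"
proof -
  obtain q r where qr: "q \<in> poly_space (k - 1)" "k = 0 \<longrightarrow> q = (\<lambda>x. 0)" "degree r \<le> k"
    "\<And>x. p x = bary v x i * q x + poly r (bary v x (i + 1))"
    using pspace_split_first[OF p[unfolded poly_space_bary[of k i]]] unfolding poly_space_bary[of "k - 1" i]
    by metis
  have "inj_on (\<lambda>x. bary v x (i + 1)) S"
  proof (rule inj_onI)
    fix x y assume xy: "x \<in> S" "y \<in> S" "bary v x (i + 1) = bary v y (i + 1)"
    have "bary v x (i + 2) = bary v y (i + 2)"
      using sum_bary[of x] sum_bary[of y] xy S(2) by (simp add: sum_3_from[of _ i])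
    then show "x = y"
      using bary_combination[of x] bary_combination[of y] xy S(2) by (simp add: sum_3_from[of _ i])
  qed
  then have "k < card ((\<lambda>x. bary v x (i + 1)) ` S)" using S by (simp add: card_image)
  moreover have "(\<lambda>x. bary v x (i + 1)) ` S \<subseteq> {t. poly r t = 0}"
  proof clarify
    fix x assume "x \<in> S"
    then show "poly r (bary v x (i + 1)) = 0" using qr(4)[of x] S(2,3) by simp
  qed
  moreover have "card A \<le> k" if "r \<noteq> 0" "A \<subseteq> {t. poly r t = 0}" for A
    using card_mono[OF poly_roots_finite[OF that(1)] that(2)] card_poly_roots_bound[OF that(1)] qr(3) by linarith
  ultimately have "r = 0" by (meson not_le)
  then have "p x = bary v x i * q x" for x using qr(4)[of x] by simp
  then show ?thesis using qr(1,2) by blast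
qed

text \<open>
  The Gauss--Lobatto nodes inside the edge opposite to vertex \<open>i\<close>, on which \<open>\<lambda>\<^sub>i\<close> vanishes.
\<close>

definition edge_nodes :: "nat \<Rightarrow> 3 \<Rightarrow> (real^2) set" where
  "edge_nodes k i = (\<lambda>s. linepath (v (i + 1)) (v (i + 2)) ((1 + s) / 2)) ` gauss_lobatto_interior k"

lemma bary_linepath: "bary v (linepath x y t) i = (1 - t) * bary v x i + t * bary v y i"
  unfolding linepath_def by (rule bary_affine_combination) simp

lemma edge_nodes_subset: "edge_nodes k i \<subseteq> boundary_points v k"
proof -
  have "linepath (v (i + 1)) (v (i + 2)) ((1 + s) / 2) \<in> boundary_points v k"
    if "s \<in> gauss_lobatto_interior k" for s
    unfolding boundary_points_def using that
    by (intro UnI2 CollectI exI[of _ "i + 1"] exI[of _ s]) (simp add: add.assoc)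
  then show ?thesis unfolding edge_nodes_def by auto
qed

lemma bary_edge_nodes:
  assumes "x \<in> edge_nodes k i"
  shows "bary v x i = 0" "bary v x (i + 1) > 0" "bary v x (i + 2) > 0"
  using assms by (auto simp: edge_nodes_def bary_linepath bary_vertex gauss_lobatto_interior_def field_simps)

lemma card_edge_nodes:
  assumes "k \<ge> 1"
  shows "finite (edge_nodes k i)" "k - 1 \<le> card (edge_nodes k i)"
proof -
  have "inj_on (\<lambda>s. linepath (v (i + 1)) (v (i + 2)) ((1 + s) / 2)) (gauss_lobatto_interior k)"
  proof (rule inj_onI)
    fix s t assume "linepath (v (i + 1)) (v (i + 2)) ((1 + s) / 2) = linepath (v (i + 1)) (v (i + 2)) ((1 + t) / 2)"
    from arg_cong[OF this, of "\<lambda>x. bary v x (i + 2)"] show "s = t"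
      by (simp add: bary_linepath bary_vertex)
  qed
  then show "k - 1 \<le> card (edge_nodes k i)"
    unfolding edge_nodes_def using gauss_lobatto_interior_card[OF assms] by (simp add: card_image)
qed (use gauss_lobatto_interior_card[OF assms] in \<open>simp add: edge_nodes_def\<close>)

lemma finite_boundary_points:
  assumes "k \<ge> 1"
  shows "finite (boundary_points v k)"
proof -
  have "{linepath (v i) (v (i + 1)) ((1 + s) / 2) | i s. s \<in> gauss_lobatto_interior k} =
     (\<lambda>(i, s). linepath (v i) (v (i + 1)) ((1 + s) / 2)) ` (UNIV \<times> gauss_lobatto_interior k)"
    by auto
  then show ?thesis
    unfolding boundary_points_def using gauss_lobatto_interior_card[OF assms] by simp
qed

lemma boundary_points_bary:
  assumes "x \<in> boundary_points v k"
  shows "x \<in> triangle_of v" "bubble v x = 0"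
proof -
  have "(\<forall>i. 0 \<le> bary v x i) \<and> (\<exists>i. bary v x i = 0)"
  proof (cases "x \<in> range v")
    case True
    then obtain j where "x = v j" by blast
    then show ?thesis by (auto simp: bary_vertex intro!: exI[of _ "j + 1"])
  next
    case False
    then obtain i s where st: "x = linepath (v i) (v (i + 1)) ((1 + s) / 2)" "s \<in> gauss_lobatto_interior k"
      using assms unfolding boundary_points_def by blast
    have "bary v x j \<ge> 0" for j
      using st by (auto simp: bary_linepath bary_vertex gauss_lobatto_interior_def)
    moreover have "bary v x (i + 2) = 0"
      using st by (auto simp: bary_linepath bary_vertex)
    ultimately show ?thesis by blast
  qed
  then show "x \<in> triangle_of v" "bubble v x = 0"
    unfolding triangle_eq bubble_def by auto
qed

text \<open>
  The three coordinates are divided out one after the other. The degree and the number of usable nodes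
  decrease together: the first edge offers all its \<open>k + 1\<close> nodes, on the second edge the vertex on the
  first edge is lost because \<open>\<lambda>\<^sub>1\<close> vanishes there, and on the third edge both end points are lost. This
  leaves \<open>k + 1\<close>, \<open>k\<close> and \<open>k - 1\<close> nodes for the degrees \<open>k\<close>, \<open>k - 1\<close> and \<open>k - 2\<close>.
\<close>

lemma zero_at_boundary_points_imp_bubble_multiple:
  assumes k: "k \<ge> 1" and p: "p \<in> poly_space k"
    and zero: "\<And>x. x \<in> boundary_points v k \<Longrightarrow> p x = 0"
  shows "\<exists>q\<in>poly_space (k - 2). \<forall>x. p x = bubble v x * q x"
proof -
  have vert: "v i \<in> boundary_points v k" for i by (simp add: boundary_points_def)
  have node: "x \<in> boundary_points v k" if "x \<in> edge_nodes k i" for x i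
    using that edge_nodes_subset by blast
  have nv: "v j \<notin> edge_nodes k i" for i j
  proof
    assume "v j \<in> edge_nodes k i"
    from bary_edge_nodes[OF this] show False
      by (auto simp: bary_vertex split: if_splits)
  qed
  note card = card_edge_nodes[OF k]
  have "v 2 \<noteq> v 3" using bary_vertex[of 2 2] bary_vertex[of 3 2] by auto
  then have "card (insert (v 2) (insert (v 3) (edge_nodes k 1))) = Suc (Suc (card (edge_nodes k 1)))"
    using card nv by simp
  then have "k < card (insert (v 2) (insert (v 3) (edge_nodes k 1)))" using card(2)[of 1] by simp
  from divide_by_bary[OF p this, of 1]
  obtain q1 where q1: "q1 \<in> poly_space (k - 1)" "\<And>x. p x = bary v x 1 * q1 x"
    using bary_edge_nodes(1)[of _ k 1] zero vert node by (force simp: bary_vertex)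
  have "k - 1 < card (insert (v 1) (edge_nodes k 2))"
    using card(2)[of 2] card(1) nv k by simp
  from divide_by_bary[OF q1(1) this, of 2]
  obtain q2 where q2: "q2 \<in> poly_space (k - 2)" "k = 1 \<longrightarrow> q2 = (\<lambda>x. 0)" "\<And>x. q1 x = bary v x 2 * q2 x"
  proof (rule bexE[rotated 2])
    fix x assume x: "x \<in> insert (v 1) (edge_nodes k 2)"
    show "bary v x 2 = 0" using x bary_edge_nodes(1)[of x k 2] by (auto simp: bary_vertex)
    have "bary v x 1 \<noteq> 0" using x bary_edge_nodes(3)[of x k 2] by (auto simp: bary_vertex)
    then show "q1 x = 0" using x q1(2)[of x] zero vert node by auto
  qed (use k in \<open>auto simp: diff_Suc numeral_2_eq_2 split: nat.splits\<close>)
  show ?thesis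
  proof (cases "k = 1")
    case True
    then show ?thesis using q1 q2 by (intro bexI[of _ q2]) (auto simp: bubble_eq)
  next
    case False
    have "k - 2 < card (edge_nodes k 3)" using card(2)[of 3] k False by simp
    from divide_by_bary[OF q2(1) this, of 3]
    obtain q3 where q3: "q3 \<in> poly_space (k - 2 - 1)" "\<And>x. q2 x = bary v x 3 * q3 x"
    proof (rule bexE[rotated 2])
      fix x assume x: "x \<in> edge_nodes k 3"
      show "bary v x 3 = 0" using x bary_edge_nodes(1)[of x k 3] by auto
      have "bary v x 1 \<noteq> 0" "bary v x 2 \<noteq> 0" using x bary_edge_nodes(2,3)[of x k 3] by auto
      then show "q2 x = 0" using x q1(2)[of x] q2(3)[of x] zero node by auto
    qed blast
    have "q3 \<in> poly_space (k - 2)"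
      using q3(1) pspace_mono unfolding poly_space_eq_pspace by fastforce
    then show ?thesis using q1 q2 q3 by (intro bexI[of _ q3]) (auto simp: bubble_eq)
  qed
qed

text \<open>
  Multiplication by \<open>\<lambda>\<^sub>1 + \<lambda>\<^sub>2 + \<lambda>\<^sub>3 = 1\<close>.
\<close>

lemma bary_monom_raise: "bary_monom v \<mu> x = (\<Sum>i\<in>UNIV. bary_monom v (\<mu>(i := Suc (\<mu> i))) x)"
proof -
  have "bary_monom v (\<mu>(i := Suc (\<mu> i))) x = bary v x i * bary_monom v \<mu> x" for i
    by (simp add: bary_monom_def prod_3_from[of _ i])
  then show ?thesis
    using sum_bary[of x] by (simp add: sum_distrib_right[symmetric])
qed

text \<open>
  The barycentric monomials of degree exactly \<open>m\<close> span all polynomials of degree at most \<open>m\<close>, because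
  the degree can be raised without changing the function. Here this appears as an induction that carries
  the orthogonality from degree \<open>m\<close> down to all lower degrees.
\<close>

lemma orthogonal_to_bary_monoms:
  assumes w: "w \<in> poly_space l"
    and orth: "\<And>\<mu>. (\<Sum>i\<in>UNIV. \<mu> i) = m \<Longrightarrow> (LINT x:triangle_of v|lborel. bary_monom v \<mu> x * w x) = 0"
    and q: "q \<in> poly_space m"
  shows "(LINT x:triangle_of v|lborel. q x * w x) = 0"
proof -
  have int: "set_integrable lborel (triangle_of v) (\<lambda>x. f x * w x)" if "f \<in> poly_space n" for f n
    using set_integrable_poly[OF poly_space_multI[OF that w]] .
  have low: "(LINT x:triangle_of v|lborel. bary_monom v \<mu> x * w x) = 0" if "(\<Sum>i\<in>UNIV. \<mu> i) + d = m" for \<mu> d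
    using that
  proof (induction d arbitrary: \<mu>)
    case (Suc d)
    have "(LINT x:triangle_of v|lborel. bary_monom v (\<mu>(i := Suc (\<mu> i))) x * w x) = 0" for i
      using Suc.prems by (intro Suc.IH) (simp add: sum_3_from[of _ i])
    moreover have "(LINT x:triangle_of v|lborel. bary_monom v \<mu> x * w x) =
      (LINT x:triangle_of v|lborel. (\<Sum>i\<in>UNIV. bary_monom v (\<mu>(i := Suc (\<mu> i))) x * w x))"
      by (subst bary_monom_raise) (simp add: sum_distrib_right)
    ultimately show ?case
      using int[OF bary_monom_poly_space] by (simp add: sum_3 set_integral_add)
  qed (use orth in simp)
  from q have "q \<in> poly_space m \<and> (LINT x:triangle_of v|lborel. q x * w x) = 0"
    unfolding poly_space_bary[of _ 1]
  proof (induction rule: pspace_induct)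
    case zero
    then show ?case by (simp add: pspace_zero set_lebesgue_integral_def)
  next
    case (monom i j)
    let ?\<mu> = "(\<lambda>_. 0)(1 := i, 2 := j) :: 3 \<Rightarrow> nat"
    have "bary_monom v ?\<mu> x = bary v x 1 ^ i * bary v x (1 + 1) ^ j" for x
      by (simp add: bary_monom_def prod_3_from[of _ 1])
    then show ?case
      using low[of ?\<mu> "m - (i + j)"] pspace_monom[OF monom] monom by (simp add: sum_3)
  next
    case (add p q)
    then show ?case
      using int[of p m] int[of q m] unfolding poly_space_bary[of _ 1]
      by (auto simp: distrib_right set_integral_add intro: pspace_add)
  next
    case (scale c p)
    then show ?case by (auto simp: mult.assoc intro: pspace_scale)
  qed
  then show ?thesis by blast
qed

lemma moment_eq_0_iff: "moment v \<mu> p = 0 \<longleftrightarrow> (LINT x:triangle_of v|lborel. bary_monom v \<mu> x * p x) = 0"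
  by (simp add: moment_def area_nonzero)

text \<open>
  If all degrees of freedom of \<open>w\<close> vanish, then \<open>w = b h\<close> with \<open>h\<close> of degree at most \<open>k - 2\<close>, and the moments
  say that \<open>b h\<close> is orthogonal to all such polynomials, in particular to \<open>h\<close>. Since \<open>b \<ge> 0\<close> on the triangle,
  \<open>\<integral> b h\<^sup>2 = 0\<close> forces \<open>b h = 0\<close>.
\<close>

theorem unisolvence:
  assumes k: "k \<ge> 1" and w: "w \<in> approx_space v k"
    and vals: "\<And>\<sigma>. \<sigma> \<in> boundary_points v k \<Longrightarrow> w \<sigma> = 0"
    and moments: "\<And>\<mu>. \<mu> \<in> moment_indices k \<Longrightarrow> moment v \<mu> w = 0"
  shows "w x = 0"
proof -
  obtain p q where pq: "p \<in> poly_space k" "q \<in> poly_space (k - 2)" "w = (\<lambda>x. p x + bubble v x * q x)"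
    using w unfolding approx_space_eq by blast
  have "p \<sigma> = 0" if "\<sigma> \<in> boundary_points v k" for \<sigma>
    using vals[OF that] boundary_points_bary(2)[OF that] pq(3) by simp
  then obtain s where s: "s \<in> poly_space (k - 2)" "\<And>x. p x = bubble v x * s x"
    using zero_at_boundary_points_imp_bubble_multiple[OF k pq(1)] by blast
  define h where "h = (\<lambda>x. s x + q x)"
  have h: "h \<in> poly_space (k - 2)" unfolding h_def using s pq by (intro poly_space_addI)
  have w_eq: "w x = bubble v x * h x" for x by (simp add: pq(3) s h_def algebra_simps)
  have bh: "(\<lambda>x. bubble v x * h x) \<in> poly_space (3 + (k - 2))"
    by (intro poly_space_multI bubble_poly_space h)
  have "(LINT x:triangle_of v|lborel. bary_monom v \<mu> x * (bubble v x * h x)) = 0"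
    if "(\<Sum>i\<in>UNIV. \<mu> i) = k - 2" for \<mu>
    using moments[of \<mu>] that by (simp add: moment_indices_eq moment_eq_0_iff w_eq)
  then have zero: "(LINT x:triangle_of v|lborel. h x * (bubble v x * h x)) = 0"
    using orthogonal_to_bary_monoms[OF bh _ h] by blast
  have "0 \<le> bubble v x" if "x \<in> triangle_of v" for x
    using that unfolding triangle_eq bubble_def by (auto intro: prod_nonneg)
  then have "h x * (bubble v x * h x) = 0"
    using nonneg_poly_integral_zero[OF poly_space_multI[OF h bh] _ zero]
    by (simp add: mult.left_commute[of _ "bubble v _"] zero_le_mult_iff)
  then show ?thesis by (auto simp: w_eq)
qed

end

section \<open>Divergence theorem on the triangle\<close>

definition vec2 :: "real \<times> real \<Rightarrow> real^2" where
  "vec2 z = (\<chi> i. if i = 1 then fst z else snd z)"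

lemma vec2_nth [simp]: "vec2 z $ 1 = fst z" "vec2 z $ 2 = snd z"
  by (simp_all add: vec2_def)

lemma Basis_real2: "(Basis :: (real^2) set) = {axis 1 1, axis 2 1}"
  by (auto simp: Basis_vec_def UNIV_2)

lemma vec2_measurable [measurable]: "vec2 \<in> borel_measurable borel"
proof -
  have "continuous_on UNIV (\<lambda>z::real \<times> real. if i = 1 then fst z else snd z)" for i :: 2
    by (cases "i = 1") (auto intro!: continuous_intros)
  then have "continuous_on UNIV vec2"
    unfolding vec2_def by (intro continuous_on_vec_lambda)
  then show ?thesis by (rule borel_measurable_continuous_onI)
qed

text \<open>
  Identifying the plane with a product makes Fubini's theorem applicable.
\<close>

lemma distr_vec2: "distr lborel borel vec2 = lborel"
proof (rule lborel_eqI[symmetric])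
  fix l u :: "real^2" assume lu: "\<And>b. b \<in> Basis \<Longrightarrow> l \<bullet> b \<le> u \<bullet> b"
  have "l $ 1 \<le> u $ 1" "l $ 2 \<le> u $ 2"
    using lu[of "axis 1 1"] lu[of "axis 2 1"] by (auto simp: Basis_real2 inner_axis)
  have "vec2 -` box l u = box (l $ 1) (u $ 1) \<times> box (l $ 2) (u $ 2)"
    by (auto simp: mem_box_cart forall_2 mem_box)
  then have "emeasure (distr lborel borel vec2) (box l u) =
      emeasure (lborel \<Otimes>\<^sub>M lborel) (box (l $ 1) (u $ 1) \<times> box (l $ 2) (u $ 2))"
    by (simp add: emeasure_distr lborel_prod)
  also have "\<dots> = emeasure lborel (box (l $ 1) (u $ 1)) * emeasure lborel (box (l $ 2) (u $ 2))"
    by (intro lborel.emeasure_pair_measure_Times) auto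
  also have "\<dots> = ennreal ((u $ 1 - l $ 1) * (u $ 2 - l $ 2))"
    using \<open>l $ 1 \<le> u $ 1\<close> \<open>l $ 2 \<le> u $ 2\<close> by (simp add: ennreal_mult)
  also have "(u $ 1 - l $ 1) * (u $ 2 - l $ 2) = (\<Prod>b\<in>Basis. (u - l) \<bullet> b)"
    by (simp add: Basis_real2 inner_axis axis_eq_axis)
  finally show "emeasure (distr lborel borel vec2) (box l u) = (\<Prod>b\<in>Basis. (u - l) \<bullet> b)" .
qed simp

definition ref_triangle :: "(real^2) set" where
  "ref_triangle = {y. 0 \<le> y $ 1 \<and> 0 \<le> y $ 2 \<and> y $ 1 + y $ 2 \<le> 1}"

lemma compact_ref_triangle: "compact ref_triangle"
proof -
  have "closed ref_triangle"
    unfolding ref_triangle_def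
    by (intro closed_Collect_conj closed_Collect_le continuous_intros)
  moreover have "ref_triangle \<subseteq> cbox 0 1"
    by (auto simp: ref_triangle_def mem_box_cart forall_2)
  ultimately show ?thesis
    using compact_Int_closed[OF compact_cbox, of ref_triangle 0 1] by (simp add: Int_absorb1)
qed

lemma affine_image_integral:
  fixes f :: "real^2 \<Rightarrow> real" and p d e :: "real^2"
  assumes f: "continuous_on UNIV f" and J: "cross2 d e \<noteq> 0"
  defines "\<Phi> \<equiv> \<lambda>y::real^2. p + y $ 1 *\<^sub>R d + y $ 2 *\<^sub>R e"
  shows "(LINT x:\<Phi> ` ref_triangle|lborel. f x) = \<bar>cross2 d e\<bar> * (LINT y:ref_triangle|lborel. f (\<Phi> y))"
proof -
  define L where "L = (\<lambda>y::real^2. y $ 1 *\<^sub>R d + y $ 2 *\<^sub>R e)"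
  have linL: "linear L"
    unfolding L_def by (rule linearI) (simp_all add: algebra_simps)
  have "\<Phi> = (\<lambda>y. p + L y)" by (simp add: \<Phi>_def L_def fun_eq_iff)
  then have der: "(\<Phi> has_derivative L) (at y within S)" for y S
    using linL by (auto intro!: derivative_eq_intros linear_imp_has_derivative)
  have det: "det (matrix L) = cross2 d e"
    by (simp add: det_2 matrix_def L_def cross2_def axis_def)
  have "inj L" using linL J det by (simp add: det_nz_iff_inj[symmetric])
  then have inj: "inj_on \<Phi> ref_triangle"
    using \<open>\<Phi> = _\<close> by (auto simp: inj_on_def)
  have cont: "continuous_on S \<Phi>" for S
    unfolding \<Phi>_def by (intro continuous_intros)
  have meas: "ref_triangle \<in> sets lebesgue"
    using compact_ref_triangle by (simp add: compact_imp_closed)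
  have compact: "compact (\<Phi> ` ref_triangle)"
    by (intro compact_continuous_image cont compact_ref_triangle)
  have int: "set_integrable lborel (\<Phi> ` ref_triangle) f"
    by (intro set_integrable_compact compact continuous_on_subset[OF f]) simp
  have int': "set_integrable lborel ref_triangle (\<lambda>y. f (\<Phi> y))"
    by (intro set_integrable_compact compact_ref_triangle continuous_on_compose2[OF f cont]) simp
  have abs_int: "f absolutely_integrable_on \<Phi> ` ref_triangle"
    using int unfolding set_integrable_def by (subst integrable_completion) auto
  \<comment> \<open>the transformation formula applies to integrands with values in a coordinate space\<close>
  let ?f = "\<lambda>x. vec (f x) :: real^1"
  have "?f absolutely_integrable_on \<Phi> ` ref_triangle"
    using abs_int by (simp add: absolutely_integrable_on_1_iff)
  then have "integral ref_triangle (\<lambda>y. \<bar>det (matrix L)\<bar> *\<^sub>R ?f (\<Phi> y)) = integral (\<Phi> ` ref_triangle) ?f"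
    using has_absolute_integral_change_of_variables[OF meas der inj, of ?f] by blast
  then have "integral ref_triangle (\<lambda>y. \<bar>cross2 d e\<bar> * f (\<Phi> y)) = integral (\<Phi> ` ref_triangle) f"
    by (simp add: integral_on_1_eq det vec_eq_iff)
  then show ?thesis
    using set_borel_integral_eq_integral(2)[OF int] set_borel_integral_eq_integral(2)[OF int'] by simp
qed

lemma ref_triangle_iterated_integral:
  fixes f :: "real^2 \<Rightarrow> real"
  assumes f: "continuous_on UNIV f"
  shows "(LINT y:ref_triangle|lborel. f y) =
    (LINT t:{0..1}|lborel. (LINT s:{0..1 - t}|lborel. f (vec2 (s, t))))"
proof -
  let ?F = "\<lambda>y. indicator ref_triangle y *\<^sub>R f y"
  have int: "integrable lborel ?F"
    using set_integrable_compact[OF compact_ref_triangle continuous_on_subset[OF f]]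
    by (simp add: set_integrable_def)
  then have F_meas: "?F \<in> borel_measurable borel" by (simp add: borel_measurable_integrable)
  have "integrable (distr lborel borel vec2) ?F" using int by (simp only: distr_vec2)
  then have "integrable lborel (\<lambda>z. ?F (vec2 z))"
    by (rule integrable_distr[rotated]) simp
  then have int2: "integrable (lborel \<Otimes>\<^sub>M lborel) (case_prod (\<lambda>s t. ?F (vec2 (s, t))))"
    by (simp add: lborel_prod case_prod_unfold)
  have inner: "(LINT s|lborel. ?F (vec2 (s, t))) = indicator {0..1} t *\<^sub>R (LINT s:{0..1 - t}|lborel. f (vec2 (s, t)))" for t
  proof (cases "t \<in> {0..1}")
    case True
    then have "indicat_real ref_triangle (vec2 (s, t)) = indicator {0..1 - t} s" for s
      by (auto simp: indicator_def ref_triangle_def)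
    then show ?thesis using True by (simp add: set_lebesgue_integral_def)
  next
    case False
    then have "indicat_real ref_triangle (vec2 (s, t)) = 0" for s
      by (auto simp: indicator_def ref_triangle_def)
    then show ?thesis using False by simp
  qed
  have "(LINT y:ref_triangle|lborel. f y) = integral\<^sup>L (distr lborel borel vec2) ?F"
    by (simp add: distr_vec2 set_lebesgue_integral_def)
  also have "\<dots> = integral\<^sup>L lborel (\<lambda>z. ?F (vec2 z))"
    by (rule integral_distr) (use F_meas in simp_all)
  also have "\<dots> = integral\<^sup>L (lborel \<Otimes>\<^sub>M lborel) (case_prod (\<lambda>s t. ?F (vec2 (s, t))))"
    by (simp add: lborel_prod case_prod_unfold)
  also have "\<dots> = (LINT t|lborel. LINT s|lborel. ?F (vec2 (s, t)))"
    by (rule lborel_pair.integral_snd[OF int2, symmetric])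
  also have "\<dots> = (LINT t|lborel. indicator {0..1} t *\<^sub>R (LINT s:{0..1 - t}|lborel. f (vec2 (s, t))))"
    by (simp only: inner)
  finally show ?thesis by (simp add: set_lebesgue_integral_def)
qed

text \<open>
  The integral over the parameter interval. The length of the edge is left out because it enters the
  divergence theorem only in the product with the normal component of \<open>a\<close>.
\<close>

definition edge_integral :: "(real^2 \<Rightarrow> real) \<Rightarrow> real^2 \<Rightarrow> real^2 \<Rightarrow> real" where
  "edge_integral g x y = (LINT s:{0..1}|lborel. g (linepath x y s))"

lemma edge_integral_commute: "edge_integral g x y = edge_integral g y x"
proof -
  have "linepath x y (1 - s) = linepath y x s" for s by (simp add: linepath_def)
  moreover have "indicat_real {0..1} (1 - s) = indicator {0..1} s" for s :: real
    by (auto simp: indicator_def)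
  ultimately show ?thesis
    unfolding edge_integral_def set_lebesgue_integral_def
    by (subst lborel_integral_real_affine[of "-1" _ 1]) simp_all
qed

lemma set_integrable_edge:
  assumes "g \<in> poly_space k"
  shows "set_integrable lborel {0..1} (\<lambda>s. g (linepath x y s))"
  by (intro set_integrable_compact continuous_on_compose2[OF poly_space_continuous_on[OF assms, of UNIV]])
    (auto intro!: continuous_intros)

text \<open>
  After the affine map to the reference triangle, \<open>d \<bullet> \<nabla>\<close> is the derivative in the first variable, so the
  inner integral is evaluated by the fundamental theorem of calculus: each segment parallel to \<open>d\<close> runs
  from the side through \<open>p\<close> and \<open>p + e\<close> to the side through \<open>p + d\<close> and \<open>p + e\<close>.
\<close>

lemma integral_derivative_along_edge:
  assumes g: "g \<in> poly_space k" and J: "cross2 d e \<noteq> 0"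
  shows "(LINT x:(\<lambda>y::real^2. p + y $ 1 *\<^sub>R d + y $ 2 *\<^sub>R e) ` ref_triangle|lborel. advect d g x) =
    \<bar>cross2 d e\<bar> * (edge_integral g (p + d) (p + e) - edge_integral g p (p + e))"
proof -
  let ?\<Phi> = "\<lambda>y::real^2. p + y $ 1 *\<^sub>R d + y $ 2 *\<^sub>R e"
  have adv: "advect d g \<in> poly_space (k - 1)" by (rule advect_poly_space[OF g])
  have cont: "continuous_on UNIV (\<lambda>y. advect d g (?\<Phi> y))"
    by (intro continuous_on_compose2[OF poly_space_continuous_on[OF adv, of UNIV]]) (auto intro!: continuous_intros)
  have inner: "(LINT s:{0..1 - t}|lborel. advect d g (?\<Phi> (vec2 (s, t)))) =
      g (linepath (p + d) (p + e) t) - g (linepath p (p + e) t)" if "t \<in> {0..1}" for t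
  proof -
    let ?c = "\<lambda>s. p + s *\<^sub>R d + t *\<^sub>R e"
    have "((\<lambda>s. g (?c s)) has_vector_derivative advect d g (?c s)) (at s within S)" for s S
    proof -
      have c: "(?c has_derivative (\<lambda>h. h *\<^sub>R d)) (at s within S)"
        by (auto intro!: derivative_eq_intros)
      have "(g has_derivative (\<lambda>h. h \<bullet> grad g (?c s))) (at (?c s))"
        using poly_space_GDERIV[OF g] unfolding gderiv_def .
      from has_derivative_compose[OF c this] show ?thesis
        by (simp add: has_vector_derivative_def advect_def)
    qed
    moreover have "continuous_on {0..1 - t} (\<lambda>s. advect d g (?c s))"
      by (intro continuous_on_compose2[OF poly_space_continuous_on[OF adv, of UNIV]]) (auto intro!: continuous_intros)
    ultimately have "(LINT s:{0..1 - t}|lborel. advect d g (?c s)) = g (?c (1 - t)) - g (?c 0)"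
      unfolding set_lebesgue_integral_def using that by (intro integral_FTC_atLeastAtMost) auto
    then show ?thesis by (simp add: linepath_def algebra_simps)
  qed
  have "(LINT x:?\<Phi> ` ref_triangle|lborel. advect d g x) =
      \<bar>cross2 d e\<bar> * (LINT y:ref_triangle|lborel. advect d g (?\<Phi> y))"
    by (rule affine_image_integral[OF poly_space_continuous_on[OF adv] J])
  also have "(LINT y:ref_triangle|lborel. advect d g (?\<Phi> y)) =
      (LINT t:{0..1}|lborel. (LINT s:{0..1 - t}|lborel. advect d g (?\<Phi> (vec2 (s, t)))))"
    by (rule ref_triangle_iterated_integral[OF cont])
  also have "\<dots> = (LINT t:{0..1}|lborel. g (linepath (p + d) (p + e) t) - g (linepath p (p + e) t))"
    by (intro set_lebesgue_integral_cong allI impI inner) simp_all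
  also have "\<dots> = edge_integral g (p + d) (p + e) - edge_integral g p (p + e)"
    unfolding edge_integral_def by (intro set_integral_diff set_integrable_edge[OF g])
  finally show ?thesis .
qed

lemma convex_hull_3_image:
  "convex hull {p, q, r} = (\<lambda>y::real^2. p + y $ 1 *\<^sub>R (q - p) + y $ 2 *\<^sub>R (r - p)) ` ref_triangle"
proof (intro equalityI subsetI)
  fix x assume "x \<in> convex hull {p, q, r}"
  then obtain s t where st: "x = p + s *\<^sub>R (q - p) + t *\<^sub>R (r - p)" "0 \<le> s" "0 \<le> t" "s + t \<le> 1"
    unfolding convex_hull_3_alt by blast
  then show "x \<in> (\<lambda>y::real^2. p + y $ 1 *\<^sub>R (q - p) + y $ 2 *\<^sub>R (r - p)) ` ref_triangle"
    by (intro image_eqI[of _ _ "vec2 (s, t)"]) (simp_all add: ref_triangle_def)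
next
  fix x assume "x \<in> (\<lambda>y::real^2. p + y $ 1 *\<^sub>R (q - p) + y $ 2 *\<^sub>R (r - p)) ` ref_triangle"
  then show "x \<in> convex hull {p, q, r}"
    unfolding convex_hull_3_alt ref_triangle_def by blast
qed

context triangle
begin

lemma integral_derivative_along_side:
  assumes g: "g \<in> poly_space k" and r: "range v = {p, q, r}" and J: "\<bar>cross2 (q - p) (r - p)\<bar> = \<bar>signed_double_area\<bar>"
  shows "(LINT x:triangle_of v|lborel. advect (q - p) g x) = \<bar>signed_double_area\<bar> * (edge_integral g q r - edge_integral g p r)"
proof -
  have "cross2 (q - p) (r - p) \<noteq> 0" using J signed_double_area_nonzero by auto
  from integral_derivative_along_edge[OF g this, of p] show ?thesis
    unfolding triangle_of_def r convex_hull_3_image J by simp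
qed

text \<open>
  The direction \<open>a\<close> is decomposed along the two sides issuing from vertex 1, with coefficients given by the
  linear parts of \<open>\<lambda>\<^sub>2\<close> and \<open>\<lambda>\<^sub>3\<close>. For each side the vertices are ordered so that this side comes first.
  The result is symmetric in the vertices again because the linear parts of the three coordinates add
  up to 0. The edge from \<open>v i\<close> to \<open>v (i + 1)\<close> is opposite to vertex \<open>i + 2\<close>.
\<close>

lemma divergence_theorem:
  assumes g: "g \<in> poly_space k"
  shows "(LINT x:triangle_of v|lborel. advect a g x) =
    - \<bar>signed_double_area\<bar> * (\<Sum>i\<in>UNIV. (bary v a (i + 2) - bary v 0 (i + 2)) * edge_integral g (v i) (v (i + 1)))"
proof -
  define l where "l i = bary v a i - bary v 0 i" for i
  have l1: "l 1 = - l 2 - l 3"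
    using sum_bary[of a] sum_bary[of 0] by (simp add: l_def sum_3)
  have "a = l 1 *\<^sub>R v 1 + l 2 *\<^sub>R v 2 + l 3 *\<^sub>R v 3"
    using bary_combination[of a] bary_combination[of 0] by (simp add: l_def sum_3 algebra_simps)
  then have a: "a = l 2 *\<^sub>R (v 2 - v 1) + l 3 *\<^sub>R (v 3 - v 1)"
    by (simp add: l1 algebra_simps)
  let ?I = "\<lambda>f. LINT x:triangle_of v|lborel. f x"
  have r: "range v = {v 1, v 2, v 3}" "range v = {v 1, v 3, v 2}" unfolding UNIV_3 by auto
  have int: "set_integrable lborel (triangle_of v) (advect d g)" for d
    by (rule set_integrable_poly[OF advect_poly_space[OF g]])
  have "advect a g = (\<lambda>x. l 2 * advect (v 2 - v 1) g x + l 3 * advect (v 3 - v 1) g x)"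
    unfolding fun_eq_iff advect_def by (subst a) (simp add: inner_add_left)
  then have "?I (advect a g) = l 2 * ?I (advect (v 2 - v 1) g) + l 3 * ?I (advect (v 3 - v 1) g)"
    using int by (simp add: set_integral_add)
  also have "?I (advect (v 2 - v 1) g) = \<bar>signed_double_area\<bar> * (edge_integral g (v 2) (v 3) - edge_integral g (v 1) (v 3))"
    by (rule integral_derivative_along_side[OF g r(1)]) (simp add: signed_double_area_def)
  also have "?I (advect (v 3 - v 1) g) = \<bar>signed_double_area\<bar> * (edge_integral g (v 3) (v 2) - edge_integral g (v 1) (v 2))"
    by (rule integral_derivative_along_side[OF g r(2)]) (simp add: signed_double_area_def cross2_def algebra_simps)
  finally show ?thesis
    unfolding edge_integral_commute[of g "v 3" "v 2"] edge_integral_commute[of g "v 1" "v 3"]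
    by (simp add: sum_3 l_def[symmetric] l1 algebra_simps)
qed

text \<open>
  The outward normal is the rotated edge vector with the sign that makes it point away from the third
  vertex; its product with \<open>a\<close> is the linear part of \<open>\<lambda>\<^sub>i\<^sub>+\<^sub>2\<close> up to a factor, since the gradient of that
  coordinate is normal to the edge too.
\<close>

lemma outward_normal_flux:
  "dist (v i) (v (i + 1)) * (a \<bullet> outward_normal v i) = - \<bar>signed_double_area\<bar> * (bary v a (i + 2) - bary v 0 (i + 2))"
proof -
  define e w where "e = v (i + 1) - v i" and "w = v (i + 2) - v i"
  have Dew: "signed_double_area = cross2 e w" by (simp add: signed_double_area_from[of i] e_def w_def)
  then have "e \<noteq> 0" using signed_double_area_nonzero by (auto simp: cross2_def)
  define perp :: "real^2" where "perp = vec2 (e $ 2, - e $ 1)"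
  have perp_inner: "perp \<bullet> x = - cross2 e x" for x
    by (simp add: perp_def inner_vec_def sum_2 cross2_def)
  have norm_perp: "norm perp = norm e"
    by (simp add: perp_def norm_vec_def L2_set_def sum_2 add.commute)
  define n where "n = (sgn signed_double_area / norm e) *\<^sub>R perp"
  have "outward_normal v i = n"
    unfolding outward_normal_def e_def[symmetric] w_def[symmetric]
  proof (rule the_equality)
    have "n \<bullet> w = - \<bar>signed_double_area\<bar> / norm e"
      by (simp add: n_def perp_inner Dew[symmetric] abs_sgn mult.commute)
    then have "n \<bullet> w < 0" using \<open>e \<noteq> 0\<close> signed_double_area_nonzero by (simp add: divide_neg_pos)
    moreover have "norm n = 1"
      using \<open>e \<noteq> 0\<close> signed_double_area_nonzero by (simp add: n_def norm_perp abs_sgn_eq)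
    moreover have "n \<bullet> e = 0" by (simp add: n_def perp_inner cross2_def)
    ultimately show "norm n = 1 \<and> n \<bullet> e = 0 \<and> n \<bullet> w < 0" by blast
  next
    fix m assume m: "norm m = 1 \<and> m \<bullet> e = 0 \<and> m \<bullet> w < 0"
    \<comment> \<open>the coefficient of the orthogonal projection of \<open>m\<close> on \<open>perp\<close>\<close>
    define c where "c = (m $ 1 * e $ 2 - m $ 2 * e $ 1) / (e $ 1 ^ 2 + e $ 2 ^ 2)"
    have ne: "e $ 1 ^ 2 + e $ 2 ^ 2 \<noteq> 0"
      using \<open>e \<noteq> 0\<close> by (auto simp: vec_eq_iff forall_2 sum_power2_eq_zero_iff)
    have me: "m $ 1 * e $ 1 + m $ 2 * e $ 2 = 0" using m by (simp add: inner_vec_def sum_2)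
    have "(m $ 1 * e $ 2 - m $ 2 * e $ 1) * e $ 2 = m $ 1 * (e $ 1 ^ 2 + e $ 2 ^ 2)"
      "(m $ 1 * e $ 2 - m $ 2 * e $ 1) * - e $ 1 = m $ 2 * (e $ 1 ^ 2 + e $ 2 ^ 2)"
      using me by algebra+
    then have "m = c *\<^sub>R perp"
      using ne by (simp add: vec_eq_iff forall_2 perp_def c_def nonzero_eq_divide_eq nonzero_divide_eq_eq)
    then have c: "\<bar>c\<bar> * norm e = 1" "c * signed_double_area > 0"
      using m by (auto simp: norm_perp perp_inner Dew)
    have "c = sgn c * \<bar>c\<bar>" by (simp add: sgn_mult_abs)
    moreover have "sgn c = sgn signed_double_area" using c(2) by (auto simp: zero_less_mult_iff)
    moreover have "\<bar>c\<bar> = 1 / norm e" using c(1) \<open>e \<noteq> 0\<close> by (simp add: field_simps)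
    ultimately have "c = sgn signed_double_area / norm e" by simp
    then show "m = n" using \<open>m = c *\<^sub>R perp\<close> by (simp add: n_def)
  qed
  moreover have "dist (v i) (v (i + 1)) = norm e" by (simp add: e_def dist_norm norm_minus_commute)
  ultimately have "dist (v i) (v (i + 1)) * (a \<bullet> outward_normal v i) = - sgn signed_double_area * cross2 e a"
    using \<open>e \<noteq> 0\<close> by (simp add: n_def perp_inner inner_commute[of a])
  moreover have "cross2 e a = signed_double_area * (bary v a (i + 2) - bary v 0 (i + 2))"
  proof -
    have "i + 2 + 1 = i" "i + 2 + 2 = i + 1" using exhaust_3[of i] by auto
    then have "bary v x (i + 2) = cross2 (v i - x) (v (i + 1) - x) / signed_double_area" for x
      by (simp only: bary_eq)
    then show ?thesis using signed_double_area_nonzero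
      by (simp add: diff_divide_distrib[symmetric]) (simp add: cross2_def e_def algebra_simps)
  qed
  ultimately show ?thesis by (simp add: abs_sgn)
qed

lemma boundary_integral_flux:
  "boundary_integral v (\<lambda>n x. g x * (a \<bullet> n)) =
    - \<bar>signed_double_area\<bar> * (\<Sum>i\<in>UNIV. (bary v a (i + 2) - bary v 0 (i + 2)) * edge_integral g (v i) (v (i + 1)))"
proof -
  have "dist (v i) (v (i + 1)) * (LINT s:{0..1}|lborel. g (linepath (v i) (v (i + 1)) s) * (a \<bullet> outward_normal v i)) =
      - \<bar>signed_double_area\<bar> * (bary v a (i + 2) - bary v 0 (i + 2)) * edge_integral g (v i) (v (i + 1))" for i
    unfolding outward_normal_flux[symmetric] edge_integral_def by simp
  then show ?thesis
    unfolding boundary_integral_def by (simp add: sum_distrib_left mult.assoc)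
qed

lemma dg_residual_eq:
  assumes p: "\<phi> \<alpha> \<in> poly_space k" and w: "w \<in> poly_space l"
  shows "dg_residual v a \<phi> w \<alpha> = (LINT x:triangle_of v|lborel. \<phi> \<alpha> x * advect a w x)"
proof -
  have int: "set_integrable lborel (triangle_of v) (\<lambda>x. \<phi> \<alpha> x * advect a w x)"
    "set_integrable lborel (triangle_of v) (\<lambda>x. w x * advect a (\<phi> \<alpha>) x)"
    using p w advect_poly_space[OF p] advect_poly_space[OF w] unfolding poly_space_eq_pspace
    by (auto intro!: set_integrable_poly[unfolded poly_space_eq_pspace] pspace_mult)
  have pw: "(\<lambda>x. \<phi> \<alpha> x * w x) \<in> poly_space (k + l)"
    using p w unfolding poly_space_eq_pspace by (rule pspace_mult)
  have "boundary_integral v (\<lambda>n x. \<phi> \<alpha> x * w x * (a \<bullet> n)) =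
      (LINT x:triangle_of v|lborel. advect a (\<lambda>x. \<phi> \<alpha> x * w x) x)"
    unfolding boundary_integral_flux divergence_theorem[OF pw] ..
  also have "\<dots> = (LINT x:triangle_of v|lborel. \<phi> \<alpha> x * advect a w x) +
      (LINT x:triangle_of v|lborel. w x * advect a (\<phi> \<alpha>) x)"
    unfolding advect_mult[OF p w] by (rule set_integral_add[OF int])
  finally show ?thesis
    by (simp add: dg_residual_def advect_def inner_commute)
qed

end

section \<open>The approximation space and its dual basis\<close>

lemma Inl_Inr_dof_indices [simp]:
  "Inl \<sigma> \<in> dof_indices v k \<longleftrightarrow> \<sigma> \<in> boundary_points v k"
  "Inr \<mu> \<in> dof_indices v k \<longleftrightarrow> \<mu> \<in> moment_indices k"
  by (auto simp: dof_indices_def)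

lemma finite_moment_indices: "finite (moment_indices k)"
proof (rule finite_subset)
  show "moment_indices k \<subseteq> PiE UNIV (\<lambda>_. {..k})"
  proof
    fix \<mu> :: "3 \<Rightarrow> nat" assume "\<mu> \<in> moment_indices k"
    then have "(\<Sum>i\<in>UNIV. \<mu> i) = k - 2" by (simp add: moment_indices_eq)
    then have "\<mu> i \<le> k" for i by (simp add: sum_3_from[of \<mu> i])
    then show "\<mu> \<in> PiE UNIV (\<lambda>_. {..k})" by (simp add: PiE_def extensional_def)
  qed
qed (simp add: finite_PiE)

context triangle
begin

lemma approx_space_poly:
  assumes "w \<in> approx_space v k"
  shows "w \<in> poly_space (k + 3)"
proof -
  obtain p q where pq: "p \<in> poly_space k" "q \<in> poly_space (k - 2)" "w = (\<lambda>x. p x + bubble v x * q x)"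
    using assms unfolding approx_space_eq by blast
  have "p \<in> poly_space (k + 3)" "(\<lambda>x. bubble v x * q x) \<in> poly_space (k + 3)"
    using pq(1) poly_space_multI[OF bubble_poly_space pq(2)] unfolding poly_space_eq_pspace
    by (auto elim: pspace_mono)
  then show ?thesis unfolding pq(3) by (rule poly_space_addI)
qed

lemma approx_space_zero: "(\<lambda>x. 0) \<in> approx_space v k"
  unfolding approx_space_eq poly_space_eq_pspace
  by (intro CollectI exI[of _ "\<lambda>x. 0"]) (simp add: pspace_zero)

lemma approx_space_scale:
  assumes "w \<in> approx_space v k"
  shows "(\<lambda>x. c * w x) \<in> approx_space v k"
proof -
  obtain p q where pq: "p \<in> poly_space k" "q \<in> poly_space (k - 2)" "w = (\<lambda>x. p x + bubble v x * q x)"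
    using assms unfolding approx_space_eq by blast
  show ?thesis unfolding approx_space_eq
    by (intro CollectI exI[of _ "\<lambda>x. c * p x"] exI[of _ "\<lambda>x. c * q x"])
      (use pq in \<open>auto simp: poly_space_eq_pspace algebra_simps intro: pspace_scale\<close>)
qed

lemma approx_space_add:
  assumes "w \<in> approx_space v k" "w' \<in> approx_space v k"
  shows "(\<lambda>x. w x + w' x) \<in> approx_space v k"
proof -
  obtain p q where pq: "p \<in> poly_space k" "q \<in> poly_space (k - 2)" "w = (\<lambda>x. p x + bubble v x * q x)"
    using assms(1) unfolding approx_space_eq by blast
  obtain p' q' where pq': "p' \<in> poly_space k" "q' \<in> poly_space (k - 2)" "w' = (\<lambda>x. p' x + bubble v x * q' x)"
    using assms(2) unfolding approx_space_eq by blast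
  show ?thesis unfolding approx_space_eq
    by (intro CollectI exI[of _ "\<lambda>x. p x + p' x"] exI[of _ "\<lambda>x. q x + q' x"])
      (use pq pq' in \<open>auto simp: algebra_simps intro: poly_space_addI\<close>)
qed

lemma approx_space_sum:
  "(\<And>\<beta>. \<beta> \<in> I \<Longrightarrow> \<phi> \<beta> \<in> approx_space v k) \<Longrightarrow> (\<lambda>x. \<Sum>\<beta>\<in>I. c \<beta> * \<phi> \<beta> x) \<in> approx_space v k"
proof (induction I rule: infinite_finite_induct)
  case (insert \<beta> I)
  then have "(\<lambda>x. c \<beta> * \<phi> \<beta> x + (\<Sum>\<beta>\<in>I. c \<beta> * \<phi> \<beta> x)) \<in> approx_space v k"
    by (intro approx_space_add approx_space_scale) simp_all
  then show ?case using insert.hyps by simp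
qed (simp_all add: approx_space_zero)

text \<open>
  Differentiating the bubble gives a quadratic factor, and \<open>(a \<bullet> \<nabla>b) q\<close> is absorbed by the polynomials of
  degree \<open>k\<close>. This needs \<open>2 + (k - 2) \<le> k\<close>, which fails for \<open>k = 1\<close> because of truncation.
\<close>

lemma advect_approx_space:
  assumes "k \<ge> 2" "w \<in> approx_space v k"
  shows "advect a w \<in> approx_space v k"
proof -
  obtain p q where pq: "p \<in> poly_space k" "q \<in> poly_space (k - 2)" "w = (\<lambda>x. p x + bubble v x * q x)"
    using assms unfolding approx_space_eq by blast
  have eq: "advect a w = (\<lambda>x. (advect a p x + q x * advect a (bubble v) x) + bubble v x * advect a q x)"
    unfolding pq(3) advect_add[OF pq(1) poly_space_multI[OF bubble_poly_space pq(2)]]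
      advect_mult[OF bubble_poly_space pq(2)] by (simp add: algebra_simps)
  have "advect a p \<in> poly_space k"
    using advect_poly_space[OF pq(1)] unfolding poly_space_eq_pspace by (rule pspace_mono) simp
  moreover have "(\<lambda>x. q x * advect a (bubble v) x) \<in> poly_space k"
  proof -
    have "k - 2 + (3 - 1) = k" using assms(1) by simp
    then show ?thesis
      using poly_space_multI[OF pq(2) advect_poly_space[OF bubble_poly_space]] by metis
  qed
  moreover have "advect a q \<in> poly_space (k - 2)"
    using advect_poly_space[OF pq(2)] unfolding poly_space_eq_pspace by (rule pspace_mono) simp
  ultimately show ?thesis
    unfolding eq approx_space_eq
    by (intro CollectI exI[of _ "\<lambda>x. advect a p x + q x * advect a (bubble v) x"]
        exI[of _ "advect a q"] conjI refl poly_space_addI)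
qed

lemma integral_against_sum:
  assumes f: "f \<in> poly_space m" and "\<And>\<beta>. \<beta> \<in> I \<Longrightarrow> \<phi> \<beta> \<in> poly_space n"
  shows "(LINT x:triangle_of v|lborel. f x * (\<Sum>\<beta>\<in>I. c \<beta> * \<phi> \<beta> x)) =
    (\<Sum>\<beta>\<in>I. c \<beta> * (LINT x:triangle_of v|lborel. f x * \<phi> \<beta> x))"
  using assms(2)
proof (induction I rule: infinite_finite_induct)
  case (insert \<beta> I)
  have int: "set_integrable lborel (triangle_of v) (\<lambda>x. f x * \<phi> \<beta> x)"
    by (rule set_integrable_poly[OF poly_space_multI[OF f insert.prems]]) simp
  have "(\<lambda>x. \<Sum>\<beta>\<in>I. c \<beta> * \<phi> \<beta> x) \<in> poly_space n"
    using insert.prems unfolding poly_space_eq_pspace by (intro pspace_sum pspace_scale) simp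
  then have int': "set_integrable lborel (triangle_of v) (\<lambda>x. f x * (\<Sum>\<beta>\<in>I. c \<beta> * \<phi> \<beta> x))"
    by (rule set_integrable_poly[OF poly_space_multI[OF f]])
  have "(LINT x:triangle_of v|lborel. f x * (\<Sum>\<beta>\<in>insert \<beta> I. c \<beta> * \<phi> \<beta> x)) =
      (LINT x:triangle_of v|lborel. c \<beta> * (f x * \<phi> \<beta> x) + f x * (\<Sum>\<beta>\<in>I. c \<beta> * \<phi> \<beta> x))"
    using insert.hyps by (simp add: distrib_left mult.left_commute)
  also have "\<dots> = c \<beta> * (LINT x:triangle_of v|lborel. f x * \<phi> \<beta> x) +
      (LINT x:triangle_of v|lborel. f x * (\<Sum>\<beta>\<in>I. c \<beta> * \<phi> \<beta> x))"
    using int int' by (simp add: set_integral_add)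
  finally show ?case using insert by simp
qed (simp_all add: set_lebesgue_integral_def)

lemma dof_sum:
  assumes "\<And>\<beta>. \<beta> \<in> I \<Longrightarrow> \<phi> \<beta> \<in> poly_space n"
  shows "dof v \<alpha> (\<lambda>x. \<Sum>\<beta>\<in>I. c \<beta> * \<phi> \<beta> x) = (\<Sum>\<beta>\<in>I. c \<beta> * dof v \<alpha> (\<phi> \<beta>))"
proof (cases \<alpha>)
  case (Inr \<mu>)
  have "dof v \<alpha> (\<lambda>x. \<Sum>\<beta>\<in>I. c \<beta> * \<phi> \<beta> x) =
    1 / area v * (\<Sum>\<beta>\<in>I. c \<beta> * (LINT x:triangle_of v|lborel. bary_monom v \<mu> x * \<phi> \<beta> x))"
    unfolding Inr dof.simps moment_def
    by (simp only: integral_against_sum[OF bary_monom_poly_space assms])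
  then show ?thesis
    by (simp add: Inr moment_def sum_distrib_left mult.left_commute)
qed simp

lemma dof_add:
  assumes "p \<in> poly_space n" "q \<in> poly_space n"
  shows "dof v \<alpha> (\<lambda>x. p x + c * q x) = dof v \<alpha> p + c * dof v \<alpha> q"
  using dof_sum[of "UNIV :: bool set" "\<lambda>b. if b then p else q" n \<alpha> "\<lambda>b. if b then 1 else c"] assms
  by (simp add: UNIV_bool add.commute split: if_splits)

lemma approx_space_eq_zero:
  assumes "k \<ge> 1" "w \<in> approx_space v k" "\<And>\<alpha>. \<alpha> \<in> dof_indices v k \<Longrightarrow> dof v \<alpha> w = 0"
  shows "w x = 0"
proof (rule unisolvence[OF assms(1,2)])
  show "w \<sigma> = 0" if "\<sigma> \<in> boundary_points v k" for \<sigma>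
    using assms(3)[of "Inl \<sigma>"] that by simp
  show "moment v \<mu> w = 0" if "\<mu> \<in> moment_indices k" for \<mu>
    using assms(3)[of "Inr \<mu>"] that by simp
qed

lemma finite_dof_indices: "k \<ge> 1 \<Longrightarrow> finite (dof_indices v k)"
  unfolding dof_indices_def using finite_boundary_points finite_moment_indices by simp

end

locale dual_triangle = triangle +
  fixes k :: nat and \<phi> :: "real^2 + (3 \<Rightarrow> nat) \<Rightarrow> real^2 \<Rightarrow> real"
  assumes degree_pos: "k \<ge> 1" and dual: "dual_basis v k \<phi>"
begin

abbreviation "I \<equiv> dof_indices v k"
abbreviation "M \<equiv> mass_matrix v \<phi>"

lemma finite_I: "finite I" by (rule finite_dof_indices[OF degree_pos])

lemma basis_approx: "\<alpha> \<in> I \<Longrightarrow> \<phi> \<alpha> \<in> approx_space v k"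
  using dual unfolding dual_basis_def by blast

lemma basis_poly: "\<alpha> \<in> I \<Longrightarrow> \<phi> \<alpha> \<in> poly_space (k + 3)"
  by (rule approx_space_poly[OF basis_approx])

lemma dof_combination:
  assumes "\<alpha> \<in> I"
  shows "dof v \<alpha> (\<lambda>x. \<Sum>\<beta>\<in>I. c \<beta> * \<phi> \<beta> x) = c \<alpha>"
proof -
  have "dof v \<alpha> (\<lambda>x. \<Sum>\<beta>\<in>I. c \<beta> * \<phi> \<beta> x) = (\<Sum>\<beta>\<in>I. c \<beta> * (if \<alpha> = \<beta> then 1 else 0))"
    using assms dual
    by (subst dof_sum[of _ _ "k + 3"]) (auto simp: dual_basis_def basis_poly intro!: sum.cong)
  then show ?thesis using finite_I assms by (simp add: if_distrib[of "\<lambda>z. _ * z"] cong: if_cong)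
qed

lemma dual_expansion:
  assumes w: "w \<in> approx_space v k"
  shows "w x = (\<Sum>\<alpha>\<in>I. dof v \<alpha> w * \<phi> \<alpha> x)"
proof -
  let ?s = "\<lambda>x. \<Sum>\<alpha>\<in>I. dof v \<alpha> w * \<phi> \<alpha> x"
  have s: "?s \<in> approx_space v k" by (rule approx_space_sum[OF basis_approx])
  have "w x + (-1) * ?s x = 0"
  proof (rule approx_space_eq_zero[OF degree_pos])
    show "(\<lambda>x. w x + (-1) * ?s x) \<in> approx_space v k"
      using w approx_space_scale[OF s] by (rule approx_space_add)
    show "dof v \<alpha> (\<lambda>x. w x + (-1) * ?s x) = 0" if "\<alpha> \<in> I" for \<alpha>
      unfolding dof_add[OF approx_space_poly[OF w] approx_space_poly[OF s]] dof_combination[OF that] by simp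
  qed
  then show ?thesis by simp
qed

lemma mass_matrix_vec:
  assumes "\<alpha> \<in> I"
  shows "mat_vec I M c \<alpha> = (LINT x:triangle_of v|lborel. \<phi> \<alpha> x * (\<Sum>\<beta>\<in>I. c \<beta> * \<phi> \<beta> x))"
proof -
  have "(LINT x:triangle_of v|lborel. \<phi> \<alpha> x * (\<Sum>\<beta>\<in>I. c \<beta> * \<phi> \<beta> x)) =
      (\<Sum>\<beta>\<in>I. c \<beta> * (LINT x:triangle_of v|lborel. \<phi> \<alpha> x * \<phi> \<beta> x))"
    by (rule integral_against_sum[OF basis_poly[OF assms]]) (rule basis_poly)
  then show ?thesis by (simp add: mat_vec_def mass_matrix_def mult.commute)
qed

text \<open>
  The quadratic form of the mass matrix is \<open>\<integral> w\<^sup>2\<close> for the combination \<open>w\<close> of basis functions. It vanishes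
  only if \<open>w = 0\<close>, and then the coefficients, which are the degrees of freedom of \<open>w\<close>, vanish.
\<close>

lemma mass_matrix_invertible: "invertible_on I M"
proof (rule definite_imp_invertible_on[OF finite_I])
  show "M \<alpha> \<beta> = M \<beta> \<alpha>" for \<alpha> \<beta> by (simp add: mass_matrix_def mult.commute)
next
  fix c assume zero: "(\<Sum>\<alpha>\<in>I. c \<alpha> * mat_vec I M c \<alpha>) = 0"
  let ?w = "\<lambda>x. \<Sum>\<beta>\<in>I. c \<beta> * \<phi> \<beta> x"
  have w: "?w \<in> poly_space (k + 3)"
    by (rule approx_space_poly[OF approx_space_sum[OF basis_approx]])
  have "(\<Sum>\<alpha>\<in>I. c \<alpha> * mat_vec I M c \<alpha>) =
      (\<Sum>\<alpha>\<in>I. c \<alpha> * (LINT x:triangle_of v|lborel. ?w x * \<phi> \<alpha> x))"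
    by (intro sum.cong refl) (simp add: mass_matrix_vec mult.commute)
  also have "\<dots> = (LINT x:triangle_of v|lborel. ?w x * ?w x)"
    by (rule integral_against_sum[OF w, symmetric]) (rule basis_poly)
  finally have "?w x * ?w x = 0" for x
    using nonneg_poly_integral_zero[OF poly_space_multI[OF w w], of x] zero by simp
  then have "?w = (\<lambda>x. \<Sum>\<beta>\<in>I. 0 * \<phi> \<beta> x)" by (simp add: fun_eq_iff)
  then have "dof v \<alpha> ?w = dof v \<alpha> (\<lambda>x. \<Sum>\<beta>\<in>I. 0 * \<phi> \<beta> x)" for \<alpha> by (rule arg_cong)
  then show "\<forall>\<alpha>\<in>I. c \<alpha> = 0"
    using dof_combination[of _ c] dof_combination[of _ "\<lambda>_. 0"] by simp
qed

lemma residual_eq: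
  assumes "w \<in> approx_space v k" "\<alpha> \<in> I"
  shows "dg_residual v a \<phi> w \<alpha> = (LINT x:triangle_of v|lborel. \<phi> \<alpha> x * advect a w x)"
  by (rule dg_residual_eq[where \<phi> = \<phi> and \<alpha> = \<alpha>, OF basis_poly[OF assms(2)] approx_space_poly[OF assms(1)]])

text \<open>
  Expanding \<open>a \<bullet> \<nabla>w\<close> in the dual basis turns the residual \<open>\<integral> \<phi>\<^sub>\<alpha> a \<bullet> \<nabla>w\<close> into the mass matrix applied to the
  degrees of freedom of \<open>a \<bullet> \<nabla>w\<close>.
\<close>

lemma solved_residual:
  assumes w: "w \<in> approx_space v k" and adv: "advect a w \<in> approx_space v k" and "\<alpha> \<in> I"
  shows "mat_vec I (mat_inv_on I M) (dg_residual v a \<phi> w) \<alpha> = dof v \<alpha> (advect a w)"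
proof -
  have "dg_residual v a \<phi> w \<beta> = mat_vec I M (\<lambda>\<gamma>. dof v \<gamma> (advect a w)) \<beta>" if "\<beta> \<in> I" for \<beta>
    unfolding residual_eq[OF w that] mass_matrix_vec[OF that] dual_expansion[OF adv, symmetric] ..
  then have "mat_vec I (mat_inv_on I M) (dg_residual v a \<phi> w) \<alpha> =
      mat_vec I (mat_inv_on I M) (mat_vec I M (\<lambda>\<gamma>. dof v \<gamma> (advect a w))) \<alpha>"
    by (rule mat_vec_cong)
  also have "\<dots> = dof v \<alpha> (advect a w)"
    by (rule mat_inv_on_vec(1)[OF finite_I mass_matrix_invertible \<open>\<alpha> \<in> I\<close>])
  finally show ?thesis .
qed

lemma dg_system_iff_explicit: "dg_system v k \<phi> a T u t \<longleftrightarrow> dg_system_explicit v k \<phi> a T u t"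
  unfolding dg_system_def dg_system_explicit_def
    linear_system_solved_form[OF finite_I mass_matrix_invertible] ..

lemma dof_evolution_iff:
  "dof_evolution v k a T u t \<longleftrightarrow>
    (\<forall>\<alpha>\<in>I. \<exists>d. ((\<lambda>s. dof v \<alpha> (u s)) has_real_derivative d) (at t within T) \<and> d + dof v \<alpha> (advect a (u t)) = 0)"
  by (simp add: dof_evolution_def dof_indices_def Plus_def ball_Un)

lemma dof_evolution_iff_dg_system:
  assumes "u t \<in> approx_space v k" "advect a (u t) \<in> approx_space v k"
  shows "dof_evolution v k a T u t \<longleftrightarrow> dg_system v k \<phi> a T u t"
proof -
  have "dg_system_explicit v k \<phi> a T u t \<longleftrightarrow>
    (\<exists>d. \<forall>\<alpha>\<in>I. ((\<lambda>s. dof v \<alpha> (u s)) has_real_derivative d \<alpha>) (at t within T) \<and>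
      d \<alpha> + dof v \<alpha> (advect a (u t)) = 0)"
    unfolding dg_system_explicit_def using solved_residual[OF assms] by (simp add: ball_conj_distrib)
  then show ?thesis
    unfolding dg_system_iff_explicit dof_evolution_iff bchoice_iff by (rule sym)
qed

end

section \<open>Equivalence of the two systems\<close>

theorem mainTheorem2:
  fixes v :: "3 \<Rightarrow> real^2" and a :: "real^2" and k :: nat
    and \<phi> :: "real^2 + (3 \<Rightarrow> nat) \<Rightarrow> real^2 \<Rightarrow> real"
    and T :: "real set" and u :: "real \<Rightarrow> real^2 \<Rightarrow> real"
  assumes "k \<ge> 1"
    and "\<not> collinear (range v)"
    and "dual_basis v k \<phi>"
    and "is_interval T" and "interior T \<noteq> {}"
    and "\<forall>t\<in>T. u t \<in> approx_space v k"
  shows "(k \<ge> 2 \<longrightarrow> (\<forall>w\<in>approx_space v k. advect a w \<in> approx_space v k)) \<and>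
    invertible_on (dof_indices v k) (mass_matrix v \<phi>) \<and>
    (\<forall>t\<in>T.
       (\<forall>x. u t x = (\<Sum>\<sigma>\<in>boundary_points v k. u t \<sigma> * \<phi> (Inl \<sigma>) x)
                  + (\<Sum>\<mu>\<in>moment_indices k. moment v \<mu> (u t) * \<phi> (Inr \<mu>) x)) \<and>
       (\<forall>\<alpha>\<in>dof_indices v k.
          dg_residual v a \<phi> (u t) \<alpha> = (LINT x:triangle_of v|lborel. \<phi> \<alpha> x * advect a (u t) x)) \<and>
       (dg_system v k \<phi> a T u t \<longleftrightarrow> dg_system_explicit v k \<phi> a T u t) \<and>
       (k \<ge> 2 \<or> advect a (u t) \<in> approx_space v k \<longrightarrow>
          (dof_evolution v k a T u t \<longleftrightarrow> dg_system v k \<phi> a T u t) \<and>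
          (\<forall>\<sigma>\<in>boundary_points v k.
             mat_vec (dof_indices v k) (mat_inv_on (dof_indices v k) (mass_matrix v \<phi>))
               (dg_residual v a \<phi> (u t)) (Inl \<sigma>) = advect a (u t) \<sigma>) \<and>
          (\<forall>\<mu>\<in>moment_indices k.
             mat_vec (dof_indices v k) (mat_inv_on (dof_indices v k) (mass_matrix v \<phi>))
               (dg_residual v a \<phi> (u t)) (Inr \<mu>) =
             1 / area v * (LINT x:triangle_of v|lborel. bary_monom v \<mu> x * advect a (u t) x))))"
proof -
  interpret dual_triangle v k \<phi> by unfold_locales fact+
  have u: "u t \<in> approx_space v k" if "t \<in> T" for t
    using assms(6) that by blast
  have adv: "advect a (u t) \<in> approx_space v k"
    if "t \<in> T" "k \<ge> 2 \<or> advect a (u t) \<in> approx_space v k" for t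
    using that advect_approx_space u by blast
  show ?thesis
  proof (intro conjI ballI impI allI)
    show "advect a w \<in> approx_space v k" if "2 \<le> k" "w \<in> approx_space v k" for w
      using that by (rule advect_approx_space)
    show "invertible_on I M" by (rule mass_matrix_invertible)
    fix t assume t: "t \<in> T"
    show "u t x = (\<Sum>\<sigma>\<in>boundary_points v k. u t \<sigma> * \<phi> (Inl \<sigma>) x)
        + (\<Sum>\<mu>\<in>moment_indices k. moment v \<mu> (u t) * \<phi> (Inr \<mu>) x)" for x
      using dual_expansion[OF u[OF t], of x]
      by (simp add: dof_indices_def sum.Plus finite_boundary_points[OF assms(1)] finite_moment_indices)
    show "dg_residual v a \<phi> (u t) \<alpha> = (LINT x:triangle_of v|lborel. \<phi> \<alpha> x * advect a (u t) x)"
      if "\<alpha> \<in> I" for \<alpha>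
      by (rule residual_eq[OF u[OF t] that])
    show "dg_system v k \<phi> a T u t \<longleftrightarrow> dg_system_explicit v k \<phi> a T u t"
      by (rule dg_system_iff_explicit)
    assume "k \<ge> 2 \<or> advect a (u t) \<in> approx_space v k"
    note adv = adv[OF t this]
    show "dof_evolution v k a T u t \<longleftrightarrow> dg_system v k \<phi> a T u t"
      by (rule dof_evolution_iff_dg_system[where u = u and t = t, OF u[OF t] adv])
    show "mat_vec I (mat_inv_on I M) (dg_residual v a \<phi> (u t)) (Inl \<sigma>) = advect a (u t) \<sigma>"
      if "\<sigma> \<in> boundary_points v k" for \<sigma>
      using solved_residual[OF u[OF t] adv, of "Inl \<sigma>"] that by simp
    show "mat_vec I (mat_inv_on I M) (dg_residual v a \<phi> (u t)) (Inr \<mu>) =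
        1 / area v * (LINT x:triangle_of v|lborel. bary_monom v \<mu> x * advect a (u t) x)"
      if "\<mu> \<in> moment_indices k" for \<mu>
      using solved_residual[OF u[OF t] adv, of "Inr \<mu>"] that by (simp add: moment_def)
  qed
qed

end
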